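(* Consider the generalized ARCH model $$X_t=\sigma_t\epsilon_t,\qquad \sigma_t^2=\alpha_0+\alpha_1X_{t-1}^2+l_1L_{t-1},\qquad t\in\mathbb{Z},$$ with $\alpha_0\ge 0$, $\alpha_1,l_1>0$, where $(\sigma_t^2)_{t\in\mathbb{Z}}$ is the strictly stationary solution $$\sigma_{t+1}^2=\sum_{i=0}^\infty\left(\prod_{j=0}^{i-1}\alpha_1\epsilon_{t-j}^2\right)(\alpha_0+l_1L_{t-i}).$$ Suppose $\mathbb{E}(L_0^4)<\infty$, $\mathbb{E}(\epsilon_0^8)<\infty$ and $\alpha_1<\frac{1}{\mathbb{E}(\epsilon_0^8)^{1/4}}$. Assume further that for every fixed $m,m_1,m_2\in\mathbb{Z}$, as $t\to\infty$, $$\mathrm{Cov}(L_0,L_t)\to0,\qquad \mathrm{Cov}(L_0L_m,L_{\pm t})\to 0,\qquad \mathrm{Cov}(L_0L_{m_1},L_tL_{t+m_2})\to0 .$$ Let $s(0)\neq 0$, fix an integer $n\neq0$, and let $\boldsymbol{\gamma}_0=[\gamma(n+1),\gamma(n),\gamma(n-1),\gamma(1),\gamma(0),\mathbb{E}(X_0^4)]$. Assume that $a_0(\boldsymbol{\gamma}_0)\neq0$ and $g_0(\boldsymbol{\gamma}_0)>0$. Then the estimators $$\hat\alpha_1=\frac{-b_0(\hat{\boldsymbol{\gamma}}_{0,N})\pm\sqrt{g_0(\hat{\boldsymbol{\gamma}}_{0,N})}}{2a_0(\hat{\boldsymbol{\gamma}}_{0,N})},$$ $$\hat l_1=\sqrt{\frac{1}{s(0)}\left(\hat\alpha_1^2\hat\gamma_N(0)-2\hat\alpha_1\hat\gamma_N(1)+\hat\gamma_N(0)-\frac{\hat\mu_{2,N}\mathrm{Var}(\epsilon_0^2)}{\mathbb{E}(\epsilon_0^4)}\right)},$$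 $$\hat\alpha_0=\hat\mu_N(1-\hat\alpha_1)-\hat l_1,$$ where the sign $\pm$ is the correct one, i.e. the one for which $\alpha_1=\frac{-b_0(\boldsymbol{\gamma}_0)\pm\sqrt{g_0(\boldsymbol{\gamma}_0)}}{2a_0(\boldsymbol{\gamma}_0)}$, are consistent: $\hat\alpha_1\to\alpha_1$, $\hat l_1\to l_1$ and $\hat\alpha_0\to\alpha_0$ in probability as $N\to\infty$.
   Context: Standing assumptions on the model: $(\epsilon_t)_{t\in\mathbb{Z}}$ is an i.i.d. process with $\mathbb{E}(\epsilon_0)=0$ and $\mathbb{E}(\epsilon_0^2)=1$; $(L_t)_{t\in\mathbb{Z}}$ (the liquidity) is a strictly stationary positive process with $\mathbb{E}(L_0)=1$, independent of $(\epsilon_t)_{t\in\mathbb{Z}}$. The empty product is $1$. Notation: $\gamma(k)=\mathrm{Cov}(X_t^2,X_{t+k}^2)$ and $s(k)=\mathrm{Cov}(L_t,L_{t+k})=\mathbb{E}(L_tL_{t+k})-1$; the function $s$ and the moments of $\epsilon_0$ are treated as known. For a vector $\mathbf{v}=[v_1,\dots,v_6]$ in the place of $[\gamma(n+1),\gamma(n),\gamma(n-1),\gamma(1),\gamma(0),\mathbb{E}(X_0^4)]$, set $$a_0(\mathbf v)=v_2-\tfrac{s(n)}{s(0)}v_5,\quad b_0(\mathbf v)=2\tfrac{s(n)}{s(0)}v_4-(v_1+v_3),\quad c_0(\mathbf v)=v_2+\tfrac{s(n)}{s(0)}\left(\tfrac{v_6\,\mathrm{Var}(\epsilon_0^2)}{\mathbb{E}(\epsilon_0^4)}-v_5\right),$$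 and $g_0(\mathbf v)=b_0(\mathbf v)^2-4a_0(\mathbf v)c_0(\mathbf v)$. Given observations $X_1^2,\dots,X_N^2$, set $\hat\mu_N=\frac1N\sum_{t=1}^NX_t^2$, $\hat\mu_{2,N}=\frac1N\sum_{t=1}^NX_t^4$, and for $k\ge0$ $$\hat\gamma_N(k)=\frac1N\sum_{t=1}^{N-k}(X_t^2-\hat\mu_N)(X_{t+k}^2-\hat\mu_N),$$ with $\hat\gamma_N(-k)=\hat\gamma_N(k)$. Then $\hat{\boldsymbol{\gamma}}_{0,N}=[\hat\gamma_N(n+1),\hat\gamma_N(n),\hat\gamma_N(n-1),\hat\gamma_N(1),\hat\gamma_N(0),\hat\mu_{2,N}]$. For finite $N$ the estimators may be complex-valued (a square root of a negative number is taken in $\mathbb{C}$); on the event where a denominator vanishes they may be assigned any fixed value. *)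

theory Defs
  imports "HOL-Probability.Probability"
begin

definition strictly_stationary :: "'a measure \<Rightarrow> (int \<Rightarrow> 'a \<Rightarrow> real) \<Rightarrow> bool" where
  "strictly_stationary M Y \<longleftrightarrow>
     (\<forall>t. Y t \<in> borel_measurable M) \<and>
     (\<forall>J h. finite J \<longrightarrow>
        distr M (\<Pi>\<^sub>M t\<in>J. borel) (\<lambda>\<omega>. \<lambda>t\<in>J. Y (t + h) \<omega>) =
        distr M (\<Pi>\<^sub>M t\<in>J. borel) (\<lambda>\<omega>. \<lambda>t\<in>J. Y t \<omega>))"

definition cov :: "'a measure \<Rightarrow> ('a \<Rightarrow> real) \<Rightarrow> ('a \<Rightarrow> real) \<Rightarrow> real" where
  "cov M U V =
     prob_space.expectation M (\<lambda>\<omega>. (U \<omega> - prob_space.expectation M U) * (V \<omega> - prob_space.expectation M V))"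

text \<open>Measurability is part of the definition because \<open>measure\<close> is \<open>0\<close> on non-measurable sets.\<close>

definition converges_in_probability ::
  "'a measure \<Rightarrow> (nat \<Rightarrow> 'a \<Rightarrow> 'b::{metric_space, second_countable_topology}) \<Rightarrow> 'b \<Rightarrow> bool" where
  "converges_in_probability M Y c \<longleftrightarrow>
     (\<forall>N. Y N \<in> borel_measurable M) \<and>
     (\<forall>\<delta>>0. (\<lambda>N. measure M {\<omega> \<in> space M. dist (Y N \<omega>) c > \<delta>}) \<longlonglongrightarrow> 0)"

text \<open>
  In \<open>volatility_series\<close> the index is shifted: the series for \<open>\<sigma>\<^sup>2\<close> at time \<open>t + 1\<close> uses the
  noise and the liquidity up to time \<open>t\<close>. Only the squares of \<open>\<sigma>\<close> are determined by the model,
  and no sign of \<open>\<sigma>\<close> is imposed.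
\<close>

locale generalized_arch = prob_space M for M :: "'a measure" +
  fixes \<epsilon> L \<sigma> X :: "int \<Rightarrow> 'a \<Rightarrow> real" and \<alpha>\<^sub>0 \<alpha>\<^sub>1 l\<^sub>1 :: real
  assumes noise_indep: "indep_vars (\<lambda>_. borel) \<epsilon> UNIV"
    and noise_ident: "\<And>t. distr M borel (\<epsilon> t) = distr M borel (\<epsilon> 0)"
    and noise_mean: "integrable M (\<epsilon> 0)" "expectation (\<epsilon> 0) = 0"
    and noise_second: "integrable M (\<lambda>\<omega>. (\<epsilon> 0 \<omega>)\<^sup>2)" "expectation (\<lambda>\<omega>. (\<epsilon> 0 \<omega>)\<^sup>2) = 1"
    and liquidity_stationary: "strictly_stationary M L"
    and liquidity_pos: "\<And>t. AE \<omega> in M. L t \<omega> > 0"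
    and liquidity_mean: "integrable M (L 0)" "expectation (L 0) = 1"
    and liquidity_noise_indep:
      "indep_var (\<Pi>\<^sub>M t\<in>UNIV. borel) (\<lambda>\<omega> t. L t \<omega>) (\<Pi>\<^sub>M t\<in>UNIV. borel) (\<lambda>\<omega> t. \<epsilon> t \<omega>)"
    and param_ranges: "\<alpha>\<^sub>0 \<ge> 0" "\<alpha>\<^sub>1 > 0" "l\<^sub>1 > 0"
    and measurable_volatility: "\<And>t. random_variable borel (\<sigma> t)"
    and measurable_observable: "\<And>t. random_variable borel (X t)"
    and observable_eq: "\<And>t. AE \<omega> in M. X t \<omega> = \<sigma> t \<omega> * \<epsilon> t \<omega>"
    and volatility_eq:
      "\<And>t. AE \<omega> in M. (\<sigma> t \<omega>)\<^sup>2 = \<alpha>\<^sub>0 + \<alpha>\<^sub>1 * (X (t - 1) \<omega>)\<^sup>2 + l\<^sub>1 * L (t - 1) \<omega>"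
    and volatility_series:
      "\<And>t. AE \<omega> in M. (\<sigma> (t + 1) \<omega>)\<^sup>2 =
         (\<Sum>i. (\<Prod>j<i. \<alpha>\<^sub>1 * (\<epsilon> (t - int j) \<omega>)\<^sup>2) * (\<alpha>\<^sub>0 + l\<^sub>1 * L (t - int i) \<omega>))"

text \<open>By stationarity the following two autocovariances do not depend on the base time, here \<open>0\<close>.\<close>

definition liq_cov :: "'a measure \<Rightarrow> (int \<Rightarrow> 'a \<Rightarrow> real) \<Rightarrow> int \<Rightarrow> real" where
  "liq_cov M L k = cov M (L 0) (L k)"

definition sq_cov :: "'a measure \<Rightarrow> (int \<Rightarrow> 'a \<Rightarrow> real) \<Rightarrow> int \<Rightarrow> real" where
  "sq_cov M X k = cov M (\<lambda>\<omega>. (X 0 \<omega>)\<^sup>2) (\<lambda>\<omega>. (X k \<omega>)\<^sup>2)"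

definition gamma_vec :: "'a measure \<Rightarrow> (int \<Rightarrow> 'a \<Rightarrow> real) \<Rightarrow> int \<Rightarrow> real ^ 6" where
  "gamma_vec M X n =
     vector [sq_cov M X (n + 1), sq_cov M X n, sq_cov M X (n - 1), sq_cov M X 1, sq_cov M X 0,
             prob_space.expectation M (\<lambda>\<omega>. X 0 \<omega> ^ 4)]"

definition a0 :: "'a measure \<Rightarrow> (int \<Rightarrow> 'a \<Rightarrow> real) \<Rightarrow> int \<Rightarrow> real ^ 6 \<Rightarrow> real" where
  "a0 M L n v = v $ 2 - liq_cov M L n / liq_cov M L 0 * v $ 5"

definition b0 :: "'a measure \<Rightarrow> (int \<Rightarrow> 'a \<Rightarrow> real) \<Rightarrow> int \<Rightarrow> real ^ 6 \<Rightarrow> real" where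
  "b0 M L n v = 2 * (liq_cov M L n / liq_cov M L 0) * v $ 4 - (v $ 1 + v $ 3)"

definition c0 ::
  "'a measure \<Rightarrow> (int \<Rightarrow> 'a \<Rightarrow> real) \<Rightarrow> (int \<Rightarrow> 'a \<Rightarrow> real) \<Rightarrow> int \<Rightarrow> real ^ 6 \<Rightarrow> real" where
  "c0 M \<epsilon> L n v =
     v $ 2 + liq_cov M L n / liq_cov M L 0 *
       (v $ 6 * prob_space.variance M (\<lambda>\<omega>. (\<epsilon> 0 \<omega>)\<^sup>2) / prob_space.expectation M (\<lambda>\<omega>. \<epsilon> 0 \<omega> ^ 4)
        - v $ 5)"

definition g0 ::
  "'a measure \<Rightarrow> (int \<Rightarrow> 'a \<Rightarrow> real) \<Rightarrow> (int \<Rightarrow> 'a \<Rightarrow> real) \<Rightarrow> int \<Rightarrow> real ^ 6 \<Rightarrow> real" where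
  "g0 M \<epsilon> L n v = (b0 M L n v)\<^sup>2 - 4 * a0 M L n v * c0 M \<epsilon> L n v"

definition mu_hat :: "(int \<Rightarrow> 'a \<Rightarrow> real) \<Rightarrow> nat \<Rightarrow> 'a \<Rightarrow> real" where
  "mu_hat X N \<omega> = 1 / real N * (\<Sum>t = 1..int N. (X t \<omega>)\<^sup>2)"

definition mu2_hat :: "(int \<Rightarrow> 'a \<Rightarrow> real) \<Rightarrow> nat \<Rightarrow> 'a \<Rightarrow> real" where
  "mu2_hat X N \<omega> = 1 / real N * (\<Sum>t = 1..int N. X t \<omega> ^ 4)"

definition gamma_hat :: "(int \<Rightarrow> 'a \<Rightarrow> real) \<Rightarrow> nat \<Rightarrow> int \<Rightarrow> 'a \<Rightarrow> real" where
  "gamma_hat X N k \<omega> =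
     1 / real N * (\<Sum>t = 1..int N - \<bar>k\<bar>.
       ((X t \<omega>)\<^sup>2 - mu_hat X N \<omega>) * ((X (t + \<bar>k\<bar>) \<omega>)\<^sup>2 - mu_hat X N \<omega>))"

definition gamma_vec_hat :: "(int \<Rightarrow> 'a \<Rightarrow> real) \<Rightarrow> int \<Rightarrow> nat \<Rightarrow> 'a \<Rightarrow> real ^ 6" where
  "gamma_vec_hat X n N \<omega> =
     vector [gamma_hat X N (n + 1) \<omega>, gamma_hat X N n \<omega>, gamma_hat X N (n - 1) \<omega>,
             gamma_hat X N 1 \<omega>, gamma_hat X N 0 \<omega>, mu2_hat X N \<omega>]"

text \<open>
  The estimators are complex-valued, with \<open>csqrt\<close> the principal square root. The real number
  \<open>sg\<close> (to be \<open>1\<close> or \<open>- 1\<close>) is the sign in the quadratic formula, and \<open>d\<close> is the arbitrary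
  value of the estimator of \<open>\<alpha>\<^sub>1\<close> where its denominator vanishes.
\<close>

definition alpha1_hat ::
  "'a measure \<Rightarrow> (int \<Rightarrow> 'a \<Rightarrow> real) \<Rightarrow> (int \<Rightarrow> 'a \<Rightarrow> real) \<Rightarrow> (int \<Rightarrow> 'a \<Rightarrow> real) \<Rightarrow> int \<Rightarrow>
   real \<Rightarrow> complex \<Rightarrow> nat \<Rightarrow> 'a \<Rightarrow> complex" where
  "alpha1_hat M \<epsilon> L X n sg d N \<omega> =
     (let v = gamma_vec_hat X n N \<omega> in
      if a0 M L n v = 0 then d
      else (- of_real (b0 M L n v) + of_real sg * csqrt (of_real (g0 M \<epsilon> L n v)))
             / of_real (2 * a0 M L n v))"

definition l1_hat ::
  "'a measure \<Rightarrow> (int \<Rightarrow> 'a \<Rightarrow> real) \<Rightarrow> (int \<Rightarrow> 'a \<Rightarrow> real) \<Rightarrow> (int \<Rightarrow> 'a \<Rightarrow> real) \<Rightarrow> int \<Rightarrow>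
   real \<Rightarrow> complex \<Rightarrow> nat \<Rightarrow> 'a \<Rightarrow> complex" where
  "l1_hat M \<epsilon> L X n sg d N \<omega> =
     (let \<alpha> = alpha1_hat M \<epsilon> L X n sg d N \<omega> in
      csqrt (1 / of_real (liq_cov M L 0) *
        (\<alpha>\<^sup>2 * of_real (gamma_hat X N 0 \<omega>) - 2 * \<alpha> * of_real (gamma_hat X N 1 \<omega>)
         + of_real (gamma_hat X N 0 \<omega>)
         - of_real (mu2_hat X N \<omega> * prob_space.variance M (\<lambda>\<omega>. (\<epsilon> 0 \<omega>)\<^sup>2)
                    / prob_space.expectation M (\<lambda>\<omega>. \<epsilon> 0 \<omega> ^ 4)))))"

definition alpha0_hat ::
  "'a measure \<Rightarrow> (int \<Rightarrow> 'a \<Rightarrow> real) \<Rightarrow> (int \<Rightarrow> 'a \<Rightarrow> real) \<Rightarrow> (int \<Rightarrow> 'a \<Rightarrow> real) \<Rightarrow> int \<Rightarrow>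
   real \<Rightarrow> complex \<Rightarrow> nat \<Rightarrow> 'a \<Rightarrow> complex" where
  "alpha0_hat M \<epsilon> L X n sg d N \<omega> =
     of_real (mu_hat X N \<omega>) * (1 - alpha1_hat M \<epsilon> L X n sg d N \<omega>) - l1_hat M \<epsilon> L X n sg d N \<omega>"

text \<open>\<open>sg\<close> is the sign for which the quadratic formula at the true moments returns \<open>\<alpha>\<^sub>1\<close>.\<close>

definition correct_sign ::
  "'a measure \<Rightarrow> (int \<Rightarrow> 'a \<Rightarrow> real) \<Rightarrow> (int \<Rightarrow> 'a \<Rightarrow> real) \<Rightarrow> (int \<Rightarrow> 'a \<Rightarrow> real) \<Rightarrow> int \<Rightarrow>
   real \<Rightarrow> real \<Rightarrow> bool" where
  "correct_sign M \<epsilon> L X n \<alpha>\<^sub>1 sg \<longleftrightarrow>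
     sg \<in> {1, - 1} \<and>
     \<alpha>\<^sub>1 = (- b0 M L n (gamma_vec M X n) + sg * sqrt (g0 M \<epsilon> L n (gamma_vec M X n)))
           / (2 * a0 M L n (gamma_vec M X n))"

end

theory Submission
  imports Defs
begin

text \<open>
  The squares \<open>\<sigma>\<^sub>t\<^sup>2\<close> and \<open>X\<^sub>t\<^sup>2 = \<epsilon>\<^sub>t\<^sup>2 \<sigma>\<^sub>t\<^sup>2\<close> are series of monomials in the noise and the liquidity that
  converge geometrically in \<open>L\<^sup>2\<close>, uniformly in \<open>t\<close>, because \<open>\<alpha>\<^sub>1\<^sup>2 E \<epsilon>\<^sup>4 < 1\<close>. Two shifted monomials
  become uncorrelated at large distance: the noise parts are then independent, and the liquidity
  parts are covered by the mixing hypotheses. So averages of monomials converge in \<open>L\<^sup>2\<close>, and averages of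
  \<open>X\<^sub>t\<^sup>2\<close> and \<open>X\<^sub>t\<^sup>2 X\<^sub>t\<^sub>+\<^sub>k\<^sup>2\<close> in \<open>L\<^sup>1\<close>, by approximation. The same approximation shows that \<open>X\<^sub>t\<^sup>2 - \<sigma>\<^sub>t\<^sup>2\<close> is
  orthogonal to the past and to the liquidity; this yields the moment equations that \<open>\<alpha>\<^sub>1\<close>, \<open>l\<^sub>1\<close> and
  \<open>\<alpha>\<^sub>0\<close> solve, and the estimators are continuous functions of the empirical moments at the true values.
\<close>

section \<open>Series in \<open>L\<^sup>2\<close>\<close>

text \<open>The degrees and the norms are forced by the products \<open>X_t^2 X_{t+k}^2\<close>.
  Approximating each factor in L^2 controls the product in L^1 and no better, so the law of large
  numbers is an L^1 statement, and only the approximating monomials are treated by their variances.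
  An approximant of \<open>X_t^2\<close> has degree at most 2 in each single noise variable and at
  most 1 in the liquidity; a product of two has degrees 4 and 2; its variance has degrees 8 and 4,
  which are exactly the moments of \<epsilon> and L that are supposed finite, and the mixing of
  pairs against pairs covers the correlations. The shift invariance of the moments of X is inherited
  from the monomials, where it comes from the common law of the noise and the stationarity of L;
  this needs approximation errors that are uniform in time.\<close>

definition sq_integrable :: "'a measure \<Rightarrow> ('a \<Rightarrow> real) \<Rightarrow> bool" where
  "sq_integrable M f \<longleftrightarrow> f \<in> borel_measurable M \<and> integrable M (\<lambda>x. (f x)\<^sup>2)"

definition l2norm :: "'a measure \<Rightarrow> ('a \<Rightarrow> real) \<Rightarrow> real" where
  "l2norm M f = sqrt (\<integral>x. (f x)\<^sup>2 \<partial>M)"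

lemma l2norm_nonneg: "0 \<le> l2norm M f"
  by (simp add: l2norm_def)

lemma l2norm_power2: "(l2norm M f)\<^sup>2 = (\<integral>x. (f x)\<^sup>2 \<partial>M)"
  by (simp add: l2norm_def)

lemma sq_integrable_measurable: "sq_integrable M f \<Longrightarrow> f \<in> borel_measurable M"
  by (simp add: sq_integrable_def)

lemma sq_integrable_mult:
  assumes "sq_integrable M f" "sq_integrable M g"
  shows "integrable M (\<lambda>x. f x * g x)"
proof (rule Bochner_Integration.integrable_bound)
  show "integrable M (\<lambda>x. (f x)\<^sup>2 + (g x)\<^sup>2)"
    using assms by (auto simp: sq_integrable_def)
  show "(\<lambda>x. f x * g x) \<in> borel_measurable M"
    using assms by (auto simp: sq_integrable_def)
  have "\<bar>a * b\<bar> \<le> a\<^sup>2 + b\<^sup>2" for a b :: real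
    using sum_squares_bound[of "\<bar>a\<bar>" "\<bar>b\<bar>"] mult_nonneg_nonneg[of "\<bar>a\<bar>" "\<bar>b\<bar>"]
    unfolding abs_mult by (simp del: mult_nonneg_nonneg)
  then show "AE x in M. norm (f x * g x) \<le> norm ((f x)\<^sup>2 + (g x)\<^sup>2)"
    by auto
qed

lemma sq_integrable_cmult: "sq_integrable M f \<Longrightarrow> sq_integrable M (\<lambda>x. c * f x)"
  by (auto simp: sq_integrable_def power_mult_distrib)

lemma sq_integrable_add:
  assumes "sq_integrable M f" "sq_integrable M g"
  shows "sq_integrable M (\<lambda>x. f x + g x)"
  using assms sq_integrable_mult[OF assms]
  by (auto simp: sq_integrable_def power2_sum mult.assoc)

lemma sq_integrable_diff:
  assumes "sq_integrable M f" "sq_integrable M g"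
  shows "sq_integrable M (\<lambda>x. f x - g x)"
  using sq_integrable_add[OF assms(1) sq_integrable_cmult[OF assms(2), of "-1"]] by simp

lemma sq_integrable_sum:
  assumes "\<And>i. i \<in> I \<Longrightarrow> sq_integrable M (f i)"
  shows "sq_integrable M (\<lambda>x. \<Sum>i\<in>I. f i x)"
  using assms
  by (induction I rule: infinite_finite_induct)
     (auto intro: sq_integrable_add simp: sq_integrable_def[of M "\<lambda>x. 0"])

lemma (in prob_space) sq_integrable_const: "sq_integrable M (\<lambda>x. c)"
  by (simp add: sq_integrable_def)

lemma (in prob_space) sq_integrable_integrable:
  "sq_integrable M f \<Longrightarrow> integrable M f"
  using sq_integrable_mult[OF _ sq_integrable_const[of 1]] by simp

text \<open>Integrate \<open>|f g| \<le> (k f^2 + g^2 / k) / 2\<close> with k the ratio of the two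
  norms. Both norms are enlarged by e so that k stays positive and finite when a norm vanishes; e
  tends to 0 at the end.\<close>

lemma l2norm_Cauchy_Schwarz:
  assumes "sq_integrable M f" "sq_integrable M g"
  shows "(\<integral>x. \<bar>f x * g x\<bar> \<partial>M) \<le> l2norm M f * l2norm M g"
proof -
  define a b where "a = l2norm M f" and "b = l2norm M g"
  have nn: "0 \<le> a" "0 \<le> b" by (simp_all add: a_def b_def l2norm_nonneg)
  have *: "(\<integral>x. \<bar>f x * g x\<bar> \<partial>M) \<le> (a + e) * (b + e)" if "0 < e" for e
  proof -
    define k where "k = (b + e) / (a + e)"
    have k: "0 < k" using nn that by (simp add: k_def)
    have pw: "\<bar>f x * g x\<bar> \<le> (k * (f x)\<^sup>2 + (g x)\<^sup>2 / k) / 2" for x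
    proof -
      have "0 \<le> (k * \<bar>f x\<bar> - \<bar>g x\<bar>)\<^sup>2 / (2 * k)" using k by simp
      also have "\<dots> = (k * (f x)\<^sup>2 + (g x)\<^sup>2 / k) / 2 - \<bar>f x * g x\<bar>"
        using k by (simp add: power2_diff abs_mult field_simps power2_eq_square)
      finally show ?thesis by simp
    qed
    have "(\<integral>x. \<bar>f x * g x\<bar> \<partial>M) \<le> (\<integral>x. (k * (f x)\<^sup>2 + (g x)\<^sup>2 / k) / 2 \<partial>M)"
      using assms sq_integrable_mult[OF assms] pw
      by (intro integral_mono) (auto simp: sq_integrable_def)
    also have "\<dots> = (k * a\<^sup>2 + b\<^sup>2 / k) / 2"
      using assms by (simp add: sq_integrable_def a_def b_def l2norm_power2)
    also have "\<dots> \<le> (k * (a + e)\<^sup>2 + (b + e)\<^sup>2 / k) / 2"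
      using k nn that by (intro divide_right_mono add_mono mult_left_mono power_mono) auto
    also have "\<dots> = (a + e) * (b + e)"
      using nn that by (simp add: k_def power2_eq_square)
    finally show ?thesis .
  qed
  have "((\<lambda>e. (a + e) * (b + e)) \<longlongrightarrow> (a + 0) * (b + 0)) (at_right 0)"
    by (intro tendsto_intros)
  then have "(\<integral>x. \<bar>f x * g x\<bar> \<partial>M) \<le> (a + 0) * (b + 0)"
    using * by (intro tendsto_lowerbound[where F = "at_right 0"])
      (auto simp: eventually_at_right_less intro: eventually_mono[OF eventually_at_right_less])
  then show ?thesis by (simp add: a_def b_def)
qed

lemma l2norm_triangle:
  assumes "sq_integrable M f" "sq_integrable M g"
  shows "l2norm M (\<lambda>x. f x + g x) \<le> l2norm M f + l2norm M g"
proof (rule power2_le_imp_le)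
  have "(\<integral>x. f x * g x \<partial>M) \<le> l2norm M f * l2norm M g"
    using l2norm_Cauchy_Schwarz[OF assms] integral_abs_bound[of M "\<lambda>x. f x * g x"] by linarith
  moreover have "(l2norm M (\<lambda>x. f x + g x))\<^sup>2 =
      (l2norm M f)\<^sup>2 + (l2norm M g)\<^sup>2 + 2 * (\<integral>x. f x * g x \<partial>M)"
    using assms sq_integrable_mult[OF assms]
    by (simp add: l2norm_power2 power2_sum sq_integrable_def mult.assoc)
  ultimately show "(l2norm M (\<lambda>x. f x + g x))\<^sup>2 \<le> (l2norm M f + l2norm M g)\<^sup>2"
    by (simp add: power2_sum)
qed (simp add: l2norm_nonneg)

lemma l2norm_cmult: "l2norm M (\<lambda>x. c * f x) = \<bar>c\<bar> * l2norm M f"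
  by (simp add: l2norm_def power_mult_distrib real_sqrt_mult)

lemma l2norm_minus_commute: "l2norm M (\<lambda>x. f x - g x) = l2norm M (\<lambda>x. g x - f x)"
  by (simp add: l2norm_def power2_commute)

lemma l2norm_sum:
  assumes "\<And>i. i \<in> I \<Longrightarrow> sq_integrable M (f i)"
  shows "l2norm M (\<lambda>x. \<Sum>i\<in>I. f i x) \<le> (\<Sum>i\<in>I. l2norm M (f i))"
  using assms
proof (induction I rule: infinite_finite_induct)
  case (insert i I)
  then have "l2norm M (\<lambda>x. f i x + (\<Sum>i\<in>I. f i x)) \<le> l2norm M (f i) + l2norm M (\<lambda>x. \<Sum>i\<in>I. f i x)"
    by (intro l2norm_triangle sq_integrable_sum) auto
  with insert show ?case by auto
qed (simp_all add: l2norm_def)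

lemma (in prob_space) l1_le_l2norm:
  assumes "sq_integrable M f"
  shows "expectation (\<lambda>x. \<bar>f x\<bar>) \<le> l2norm M f"
  using l2norm_Cauchy_Schwarz[OF assms sq_integrable_const[of 1]]
  by (simp add: l2norm_def prob_space)

section \<open>Series with geometrically decaying L^2 norms\<close>

context prob_space
begin

context
  fixes f :: "nat \<Rightarrow> 'a \<Rightarrow> real" and C q :: real
  assumes f: "\<And>i. sq_integrable M (f i)"
    and bound: "\<And>i. l2norm M (f i) \<le> C * q ^ i"
    and q: "0 \<le> q" "q < 1"
begin

text \<open>On a probability space the L^1 norm is at most the L^2 norm, so the integral of the sum
  of all \<open>|f i|\<close> is dominated by a convergent geometric series, and a function with
  finite integral is finite almost everywhere.\<close>

lemma L2_series_AE_summable: "AE x in M. summable (\<lambda>i. f i x)"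
proof -
  have [measurable]: "f i \<in> borel_measurable M" for i
    using f by (rule sq_integrable_measurable)
  have C: "0 \<le> C"
    using bound[of 0] l2norm_nonneg[of M "f 0"] by simp
  have "(\<integral>\<^sup>+x. (\<Sum>i. ennreal \<bar>f i x\<bar>) \<partial>M) = (\<Sum>i. \<integral>\<^sup>+x. ennreal \<bar>f i x\<bar> \<partial>M)"
    by (rule nn_integral_suminf) auto
  also have "\<dots> \<le> (\<Sum>i. ennreal (C * q ^ i))"
  proof (rule suminf_le)
    fix i
    have "(\<integral>\<^sup>+x. ennreal \<bar>f i x\<bar> \<partial>M) = ennreal (expectation (\<lambda>x. \<bar>f i x\<bar>))"
      using sq_integrable_integrable[OF f] by (intro nn_integral_eq_integral) auto
    also have "\<dots> \<le> ennreal (C * q ^ i)"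
      using l1_le_l2norm[OF f, of i] bound[of i] by (intro ennreal_leI) linarith
    finally show "(\<integral>\<^sup>+x. ennreal \<bar>f i x\<bar> \<partial>M) \<le> ennreal (C * q ^ i)" .
  qed auto
  also have "\<dots> = ennreal (\<Sum>i. C * q ^ i)"
    using q C by (intro suminf_ennreal2) (auto intro!: summable_mult summable_geometric)
  finally have "(\<integral>\<^sup>+x. (\<Sum>i. ennreal \<bar>f i x\<bar>) \<partial>M) \<noteq> \<infinity>"
    by (auto simp: top_unique)
  then have "AE x in M. (\<Sum>i. ennreal \<bar>f i x\<bar>) \<noteq> \<infinity>"
    by (intro nn_integral_PInf_AE) auto
  then show ?thesis
  proof eventually_elim
    case (elim x)
    then have "summable (\<lambda>i. \<bar>f i x\<bar>)"
      by (intro summable_suminf_not_top) auto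
    then show ?case by (rule summable_rabs_cancel)
  qed
qed

text \<open>The sum U is known only as a pointwise limit, so the bound goes through Fatou's lemma:
  each block of terms from m to m + k has L^2 norm at most the geometric tail, and the limit
  inherits the bound. The case m = 0 gives square integrability of U itself.\<close>

lemma
  assumes [measurable]: "U \<in> borel_measurable M"
    and U: "AE x in M. U x = (\<Sum>i. f i x)"
  shows L2_series_sq_integrable: "sq_integrable M U"
    and L2_series_l2norm: "l2norm M (\<lambda>x. U x - (\<Sum>i<m. f i x)) \<le> C / (1 - q) * q ^ m"
proof -
  have [measurable]: "f i \<in> borel_measurable M" for i
    using f by (rule sq_integrable_measurable)
  have C: "0 \<le> C"
    using bound[of 0] l2norm_nonneg[of M "f 0"] by simp
  have main: "sq_integrable M (\<lambda>x. U x - (\<Sum>i<m. f i x)) \<and>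
     l2norm M (\<lambda>x. U x - (\<Sum>i<m. f i x)) \<le> C / (1 - q) * q ^ m" for m
  proof -
    define K where "K = C / (1 - q) * q ^ m"
    have K: "0 \<le> K" using C q by (simp add: K_def)
    define D where "D k x = (\<Sum>i\<in>{m..<m + k}. f i x)" for k x
    have D_int: "sq_integrable M (D k)" for k
      unfolding D_def by (intro sq_integrable_sum f)
    have D_le: "l2norm M (D k) \<le> K" for k
    proof -
      have "l2norm M (D k) \<le> (\<Sum>i\<in>{m..<m + k}. C * q ^ i)"
        unfolding D_def by (intro order.trans[OF l2norm_sum] sum_mono bound f)
      also have "\<dots> = C * q ^ m * (\<Sum>i<k. q ^ i)"
        using sum.shift_bounds_nat_ivl[of "\<lambda>i. C * q ^ i" 0 m k]
        by (simp add: sum_distrib_left power_add lessThan_atLeast0 mult_ac add.commute[of m k])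
      also have "\<dots> \<le> C * q ^ m * (\<Sum>i. q ^ i)"
        using q C by (intro mult_left_mono sum_le_suminf summable_geometric) auto
      also have "\<dots> = K" using q by (simp add: K_def suminf_geometric)
      finally show ?thesis .
    qed
    have lim: "AE x in M. (\<lambda>k. ennreal ((D k x)\<^sup>2)) \<longlonglongrightarrow> ennreal ((U x - (\<Sum>i<m. f i x))\<^sup>2)"
      using L2_series_AE_summable U
    proof eventually_elim
      case (elim x)
      have "(\<lambda>k. \<Sum>i<m + k. f i x) \<longlonglongrightarrow> U x"
        using LIMSEQ_ignore_initial_segment[OF summable_LIMSEQ[OF elim(1)], of m] elim(2)
        by (simp add: add.commute)
      moreover have "D k x = (\<Sum>i<m + k. f i x) - (\<Sum>i<m. f i x)" for k
        unfolding D_def using sum.atLeastLessThan_concat[of 0 m "m + k" "\<lambda>i. f i x"]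
        by (simp add: lessThan_atLeast0)
      ultimately have "(\<lambda>k. D k x) \<longlonglongrightarrow> U x - (\<Sum>i<m. f i x)"
        by (auto intro!: tendsto_diff)
      then show ?case by (intro tendsto_ennrealI tendsto_power)
    qed
    have "(\<integral>\<^sup>+x. ennreal ((U x - (\<Sum>i<m. f i x))\<^sup>2) \<partial>M)
        = (\<integral>\<^sup>+x. liminf (\<lambda>k. ennreal ((D k x)\<^sup>2)) \<partial>M)"
    proof (rule nn_integral_cong_AE)
      show "AE x in M. ennreal ((U x - (\<Sum>i<m. f i x))\<^sup>2) = liminf (\<lambda>k. ennreal ((D k x)\<^sup>2))"
        using lim by eventually_elim (rule lim_imp_Liminf[OF trivial_limit_sequentially, symmetric])
    qed
    also have "\<dots> \<le> liminf (\<lambda>k. \<integral>\<^sup>+x. ennreal ((D k x)\<^sup>2) \<partial>M)"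
      by (rule nn_integral_liminf) (simp add: D_def)
    also have "\<dots> \<le> liminf (\<lambda>k::nat. ennreal (K\<^sup>2))"
    proof (intro Liminf_mono always_eventually allI)
      fix k
      have "(\<integral>\<^sup>+x. ennreal ((D k x)\<^sup>2) \<partial>M) = ennreal ((l2norm M (D k))\<^sup>2)"
        using D_int by (simp add: nn_integral_eq_integral sq_integrable_def l2norm_power2)
      also have "\<dots> \<le> ennreal (K\<^sup>2)"
        using D_le by (intro ennreal_leI power_mono l2norm_nonneg)
      finally show "(\<integral>\<^sup>+x. ennreal ((D k x)\<^sup>2) \<partial>M) \<le> ennreal (K\<^sup>2)" .
    qed
    finally have le: "(\<integral>\<^sup>+x. ennreal ((U x - (\<Sum>i<m. f i x))\<^sup>2) \<partial>M) \<le> ennreal (K\<^sup>2)"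
      by (simp add: Liminf_const)
    then have int: "integrable M (\<lambda>x. (U x - (\<Sum>i<m. f i x))\<^sup>2)"
      by (intro integrableI_nn_integral_finite[where x = "enn2real (\<integral>\<^sup>+x. ennreal ((U x - (\<Sum>i<m. f i x))\<^sup>2) \<partial>M)"])
        (auto simp: ennreal_enn2real_if top_unique)
    then have "ennreal ((l2norm M (\<lambda>x. U x - (\<Sum>i<m. f i x)))\<^sup>2) \<le> ennreal (K\<^sup>2)"
      using le by (simp add: nn_integral_eq_integral l2norm_power2)
    then have "l2norm M (\<lambda>x. U x - (\<Sum>i<m. f i x)) \<le> K"
      using K by (auto simp: l2norm_nonneg intro: power2_le_imp_le)
    with int show ?thesis by (simp add: sq_integrable_def K_def)
  qed
  show "sq_integrable M U" using main[of 0] by simp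
  show "l2norm M (\<lambda>x. U x - (\<Sum>i<m. f i x)) \<le> C / (1 - q) * q ^ m" using main by blast
qed

end

end


section \<open>Laws of large numbers in \<open>L\<^sup>1\<close>\<close>

lemma Cesaro_null:
  fixes c :: "nat \<Rightarrow> real"
  assumes "c \<longlonglongrightarrow> 0"
  shows "(\<lambda>N. (\<Sum>h<N. \<bar>c h\<bar>) / real N) \<longlonglongrightarrow> 0"
proof (rule LIMSEQ_I)
  fix e :: real assume e: "0 < e"
  obtain H where H: "\<bar>c h\<bar> < e / 2" if "H \<le> h" for h
    using LIMSEQ_D[OF assms, of "e / 2"] e by auto
  define K where "K = (\<Sum>h<H. \<bar>c h\<bar>)"
  obtain N0 :: nat where N0: "2 * K / e < real N0"
    using reals_Archimedean2 by blast
  have "norm ((\<Sum>h<N. \<bar>c h\<bar>) / real N - 0) < e" if N: "N0 + H + 1 \<le> N" for N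
  proof -
    have "(\<Sum>h<N. \<bar>c h\<bar>) = K + (\<Sum>h\<in>{H..<N}. \<bar>c h\<bar>)"
      unfolding K_def using N sum.atLeastLessThan_concat[of 0 H N "\<lambda>h. \<bar>c h\<bar>"]
      by (simp add: lessThan_atLeast0)
    also have "(\<Sum>h\<in>{H..<N}. \<bar>c h\<bar>) \<le> (\<Sum>h\<in>{H..<N}. e / 2)"
      using H by (intro sum_mono) (auto intro: less_imp_le)
    also have "\<dots> \<le> real N * (e / 2)"
      using e by (simp add: mult_right_mono)
    finally have "(\<Sum>h<N. \<bar>c h\<bar>) \<le> K + real N * (e / 2)" by simp
    moreover have "K < real N * (e / 2)"
    proof -
      have "2 * K / e < real N" using N0 N by linarith
      then show ?thesis using e by (simp add: field_simps)
    qed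
    ultimately have "(\<Sum>h<N. \<bar>c h\<bar>) < real N * e" by argo
    then show ?thesis
      using N by (simp add: field_simps sum_nonneg abs_of_nonneg)
  qed
  then show "\<exists>no. \<forall>N\<ge>no. norm ((\<Sum>h<N. \<bar>c h\<bar>) / real N - 0) < e" by blast
qed

text \<open>Not ergodicity of a measure-preserving map, but its consequence that matters here: a
  constant mean and the mean ergodic theorem in L^1. Stationarity of Y is not part of it, so the
  property passes to limits of approximants.\<close>

definition ergodic :: "'a measure \<Rightarrow> (int \<Rightarrow> 'a \<Rightarrow> real) \<Rightarrow> bool" where
  "ergodic M Y \<longleftrightarrow> (\<forall>t. integrable M (Y t)) \<and>
     (\<forall>t. (\<integral>x. Y t x \<partial>M) = (\<integral>x. Y 0 x \<partial>M)) \<and>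
     (\<lambda>N. \<integral>x. \<bar>1 / real N * (\<Sum>t = 1..int N. Y t x) - (\<integral>x. Y 0 x \<partial>M)\<bar> \<partial>M) \<longlonglongrightarrow> 0"

lemma ergodicD:
  assumes "ergodic M Y"
  shows "integrable M (Y t)" "(\<integral>x. Y t x \<partial>M) = (\<integral>x. Y 0 x \<partial>M)"
    "(\<lambda>N. \<integral>x. \<bar>1 / real N * (\<Sum>t = 1..int N. Y t x) - (\<integral>x. Y 0 x \<partial>M)\<bar> \<partial>M) \<longlonglongrightarrow> 0"
  using assms unfolding ergodic_def by blast+

context prob_space
begin

text \<open>The variance of the average is \<open>1 / N^2\<close> times the sum of
  \<open>c |t - s|\<close> over all pairs. Each of the N rows is at most
  \<open>2 * (\<Sum>h<N. \<bar>c h\<bar>)\<close>, so the variance is at most twice a Cesaro mean of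
  a null sequence.\<close>

lemma ergodic_if_cov_null:
  fixes Y :: "int \<Rightarrow> 'a \<Rightarrow> real"
  assumes Y: "\<And>t. sq_integrable M (Y t)"
    and mean: "\<And>t. expectation (Y t) = y"
    and corr: "\<And>s h. expectation (\<lambda>x. Y s x * Y (s + int h) x) = r h"
    and r: "r \<longlonglongrightarrow> y\<^sup>2"
  shows "ergodic M Y"
proof -
  have int: "integrable M (Y t)" for t
    using Y by (rule sq_integrable_integrable)
  define c where "c h = r h - y\<^sup>2" for h
  have cov: "expectation (\<lambda>x. (Y s x - y) * (Y t x - y)) = c (nat \<bar>t - s\<bar>)" for s t
  proof -
    have "expectation (\<lambda>x. Y s x * Y t x) = r (nat \<bar>t - s\<bar>)"
    proof (cases "s \<le> t")
      case True then show ?thesis using corr[of s "nat (t - s)"] by simp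
    next
      case False then show ?thesis using corr[of t "nat (s - t)"] by (simp add: mult.commute)
    qed
    moreover have "expectation (\<lambda>x. (Y s x - y) * (Y t x - y)) =
        expectation (\<lambda>x. Y s x * Y t x) - y * expectation (Y t) - y * expectation (Y s) + y\<^sup>2"
      using int sq_integrable_mult[OF Y Y, of s t]
      by (simp add: algebra_simps power2_eq_square prob_space)
    ultimately show ?thesis by (simp add: mean c_def power2_eq_square)
  qed
  have c0: "c \<longlonglongrightarrow> 0"
    unfolding c_def using tendsto_diff[OF r tendsto_const[of "y\<^sup>2"]] by simp
  have var: "(l2norm M (\<lambda>x. 1 / real N * (\<Sum>t = 1..int N. Y t x) - y))\<^sup>2
      \<le> 2 * ((\<Sum>h<N. \<bar>c h\<bar>) / real N)" if N: "0 < N" for N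
  proof -
    have row: "(\<Sum>t = 1..int N. \<bar>c (nat \<bar>t - s\<bar>)\<bar>) \<le> 2 * (\<Sum>h<N. \<bar>c h\<bar>)" if s: "s \<in> {1..int N}" for s
    proof -
      \<comment> \<open>On either side of s the distance to s is injective, so each half of the row
        meets every lag at most once.\<close>
      have half: "(\<Sum>t\<in>T. \<bar>c (nat \<bar>t - s\<bar>)\<bar>) \<le> (\<Sum>h<N. \<bar>c h\<bar>)"
        if "inj_on (\<lambda>t. nat \<bar>t - s\<bar>) T" "T \<subseteq> {1..int N}" for T
      proof -
        have "(\<Sum>t\<in>T. \<bar>c (nat \<bar>t - s\<bar>)\<bar>) = (\<Sum>h\<in>(\<lambda>t. nat \<bar>t - s\<bar>) ` T. \<bar>c h\<bar>)"
          using that(1) by (simp add: sum.reindex)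
        also have "\<dots> \<le> (\<Sum>h<N. \<bar>c h\<bar>)"
          using that(2) s by (intro sum_mono2) (force simp: nat_less_iff)+
        finally show ?thesis .
      qed
      have "(\<Sum>t = 1..int N. \<bar>c (nat \<bar>t - s\<bar>)\<bar>) =
          (\<Sum>t\<in>{1..s}. \<bar>c (nat \<bar>t - s\<bar>)\<bar>) + (\<Sum>t\<in>{s+1..int N}. \<bar>c (nat \<bar>t - s\<bar>)\<bar>)"
        using s by (subst sum.union_disjoint[symmetric]) (auto intro!: sum.cong)
      also have "\<dots> \<le> (\<Sum>h<N. \<bar>c h\<bar>) + (\<Sum>h<N. \<bar>c h\<bar>)"
        using s by (intro add_mono half) (auto simp: inj_on_def)
      finally show ?thesis by simp
    qed
    have "(l2norm M (\<lambda>x. 1 / real N * (\<Sum>t = 1..int N. Y t x) - y))\<^sup>2 =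
        expectation (\<lambda>x. (1 / real N)\<^sup>2 * (\<Sum>s = 1..int N. \<Sum>t = 1..int N. (Y s x - y) * (Y t x - y)))"
      unfolding l2norm_power2
    proof (intro Bochner_Integration.integral_cong refl)
      fix x
      have "1 / real N * (\<Sum>t = 1..int N. Y t x) - y = 1 / real N * (\<Sum>t = 1..int N. Y t x - y)"
        using N by (simp add: sum_subtractf field_simps)
      then show "(1 / real N * (\<Sum>t = 1..int N. Y t x) - y)\<^sup>2 =
          (1 / real N)\<^sup>2 * (\<Sum>s = 1..int N. \<Sum>t = 1..int N. (Y s x - y) * (Y t x - y))"
        by (simp only: power_mult_distrib power2_eq_square[of "sum _ _"] sum_product)
    qed
    also have "\<dots> = (1 / real N)\<^sup>2 * (\<Sum>s = 1..int N. \<Sum>t = 1..int N. c (nat \<bar>t - s\<bar>))"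
      using sq_integrable_mult[OF sq_integrable_diff[OF Y sq_integrable_const]
          sq_integrable_diff[OF Y sq_integrable_const], of _ y _ y]
      by (simp add: cov)
    also have "\<dots> \<le> (1 / real N)\<^sup>2 * (\<Sum>s = 1..int N. 2 * (\<Sum>h<N. \<bar>c h\<bar>))"
    proof (intro mult_left_mono sum_mono)
      fix s assume "s \<in> {1..int N}"
      then show "(\<Sum>t = 1..int N. c (nat \<bar>t - s\<bar>)) \<le> 2 * (\<Sum>h<N. \<bar>c h\<bar>)"
        by (intro order.trans[OF sum_mono row]) auto
    qed simp
    also have "\<dots> = 2 * ((\<Sum>h<N. \<bar>c h\<bar>) / real N)"
      using N by (simp add: power2_eq_square)
    finally show ?thesis .
  qed
  have "(\<lambda>N. expectation (\<lambda>x. \<bar>1 / real N * (\<Sum>t = 1..int N. Y t x) - y\<bar>)) \<longlonglongrightarrow> 0"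
  proof (rule tendsto_sandwich[where f = "\<lambda>_. 0"])
    show "(\<lambda>N. sqrt (2 * ((\<Sum>h<N. \<bar>c h\<bar>) / real N))) \<longlonglongrightarrow> 0"
      using tendsto_real_sqrt[OF tendsto_mult_right_zero[OF Cesaro_null[OF c0], of 2]] by simp
    show "eventually (\<lambda>N. expectation (\<lambda>x. \<bar>1 / real N * (\<Sum>t = 1..int N. Y t x) - y\<bar>)
        \<le> sqrt (2 * ((\<Sum>h<N. \<bar>c h\<bar>) / real N))) sequentially"
      using eventually_gt_at_top[of 0]
    proof eventually_elim
      case (elim N)
      have "expectation (\<lambda>x. \<bar>1 / real N * (\<Sum>t = 1..int N. Y t x) - y\<bar>)
          \<le> l2norm M (\<lambda>x. 1 / real N * (\<Sum>t = 1..int N. Y t x) - y)"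
        by (intro l1_le_l2norm sq_integrable_diff sq_integrable_cmult sq_integrable_sum Y sq_integrable_const)
      also have "\<dots> \<le> sqrt (2 * ((\<Sum>h<N. \<bar>c h\<bar>) / real N))"
        using var[OF elim] by (rule real_le_rsqrt)
      finally show ?case .
    qed
  qed (auto intro!: always_eventually)
  then show ?thesis by (simp add: ergodic_def int mean)
qed

lemma ergodic_add:
  assumes Y: "ergodic M Y" and Z: "ergodic M Z"
  shows "ergodic M (\<lambda>t x. Y t x + Z t x)"
proof -
  note [simp] = ergodicD(1)[OF Y] ergodicD(1)[OF Z]
  define u v where "u N x = 1 / real N * (\<Sum>t = 1..int N. Y t x) - expectation (Y 0)"
    and "v N x = 1 / real N * (\<Sum>t = 1..int N. Z t x) - expectation (Z 0)" for N x
  have [simp]: "integrable M (u N)" "integrable M (v N)" for N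
    unfolding u_def[abs_def] v_def[abs_def] by simp_all
  have "(\<lambda>N. expectation (\<lambda>x. \<bar>u N x + v N x\<bar>)) \<longlonglongrightarrow> 0"
  proof (rule tendsto_sandwich[where f = "\<lambda>_. 0"])
    show "(\<lambda>N. expectation (\<lambda>x. \<bar>u N x\<bar>) + expectation (\<lambda>x. \<bar>v N x\<bar>)) \<longlonglongrightarrow> 0"
      using tendsto_add[OF ergodicD(3)[OF Y] ergodicD(3)[OF Z]] by (simp add: u_def v_def)
    show "\<forall>\<^sub>F N in sequentially. expectation (\<lambda>x. \<bar>u N x + v N x\<bar>)
        \<le> expectation (\<lambda>x. \<bar>u N x\<bar>) + expectation (\<lambda>x. \<bar>v N x\<bar>)"
    proof (intro always_eventually allI)
      fix N
      have "expectation (\<lambda>x. \<bar>u N x + v N x\<bar>) \<le> expectation (\<lambda>x. \<bar>u N x\<bar> + \<bar>v N x\<bar>)"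
        by (intro integral_mono) auto
      then show "expectation (\<lambda>x. \<bar>u N x + v N x\<bar>)
          \<le> expectation (\<lambda>x. \<bar>u N x\<bar>) + expectation (\<lambda>x. \<bar>v N x\<bar>)"
        by simp
    qed
  qed (auto intro!: always_eventually)
  moreover have "expectation (Y t) + expectation (Z t) = expectation (Y 0) + expectation (Z 0)" for t
    using ergodicD(2)[OF Y, of t] ergodicD(2)[OF Z, of t] by simp
  ultimately show ?thesis
    by (simp add: ergodic_def u_def v_def sum.distrib algebra_simps)
qed

lemma ergodic_cmult:
  assumes Y: "ergodic M Y"
  shows "ergodic M (\<lambda>t x. c * Y t x)"
proof -
  have "(\<lambda>N. \<bar>c\<bar> * expectation (\<lambda>x. \<bar>1 / real N * (\<Sum>t = 1..int N. Y t x) - expectation (Y 0)\<bar>)) \<longlonglongrightarrow> 0"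
    by (intro tendsto_mult_right_zero ergodicD(3) Y)
  then have "(\<lambda>N. expectation (\<lambda>x. \<bar>1 / real N * (\<Sum>t = 1..int N. c * Y t x) - c * expectation (Y 0)\<bar>)) \<longlonglongrightarrow> 0"
    by (simp add: integral_mult_right_zero[symmetric] abs_mult[symmetric] sum_distrib_left[symmetric]
        right_diff_distrib mult.left_commute del: integral_mult_right_zero)
  then show ?thesis
    using ergodicD(1,2)[OF Y] by (simp add: ergodic_def)
qed

text \<open>An L^1 error that is uniform in t survives averaging over t. Constancy of the mean of U
  is derived in the same way: two means differ by arbitrarily little.\<close>

lemma ergodic_approx:
  assumes U: "\<And>t. integrable M (U t)"
    and app: "\<And>e. 0 < e \<Longrightarrow> \<exists>Y. ergodic M Y \<and> (\<forall>t. expectation (\<lambda>x. \<bar>U t x - Y t x\<bar>) \<le> e)"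
  shows "ergodic M U"
proof -
  have diff: "\<bar>expectation (U t) - expectation (Y t)\<bar> \<le> e"
    if "ergodic M Y" "expectation (\<lambda>x. \<bar>U t x - Y t x\<bar>) \<le> e" for Y t e
    using integral_abs_bound[of M "\<lambda>x. U t x - Y t x"] U[of t] ergodicD(1)[OF that(1), of t] that(2)
    by simp
  have mean: "expectation (U t) = expectation (U 0)" for t
  proof -
    have "\<bar>expectation (U t) - expectation (U 0)\<bar> \<le> e" if e: "0 < e" for e
    proof -
      obtain Y where Y: "ergodic M Y" "\<And>t. expectation (\<lambda>x. \<bar>U t x - Y t x\<bar>) \<le> e / 2"
        using app[of "e / 2"] e by auto
      show ?thesis
        using diff[OF Y(1) Y(2)[of t]] diff[OF Y(1) Y(2)[of 0]] ergodicD(2)[OF Y(1), of t] by linarith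
    qed
    then have "\<bar>expectation (U t) - expectation (U 0)\<bar> \<le> 0"
      by (rule field_le_epsilon[of _ 0, simplified])
    then show ?thesis by simp
  qed
  have "(\<lambda>N. expectation (\<lambda>x. \<bar>1 / real N * (\<Sum>t = 1..int N. U t x) - expectation (U 0)\<bar>)) \<longlonglongrightarrow> 0"
  proof (rule LIMSEQ_I)
    fix e :: real assume e: "0 < e"
    obtain Y where Y: "ergodic M Y" and close: "\<And>t. expectation (\<lambda>x. \<bar>U t x - Y t x\<bar>) \<le> e / 4"
      using app[of "e / 4"] e by auto
    note [simp] = U ergodicD(1)[OF Y]
    obtain N0 where N0: "\<And>N. N0 \<le> N \<Longrightarrow>
        expectation (\<lambda>x. \<bar>1 / real N * (\<Sum>t = 1..int N. Y t x) - expectation (Y 0)\<bar>) < e / 4"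
      using LIMSEQ_D[OF ergodicD(3)[OF Y], of "e / 4"] e by auto
    have "expectation (\<lambda>x. \<bar>1 / real N * (\<Sum>t = 1..int N. U t x) - expectation (U 0)\<bar>) < e"
      if N: "N0 \<le> N" "0 < N" for N
    proof -
      define D where "D x = 1 / real N * (\<Sum>t = 1..int N. \<bar>U t x - Y t x\<bar>)" for x
      define A where "A x = 1 / real N * (\<Sum>t = 1..int N. Y t x) - expectation (Y 0)" for x
      have "expectation D = 1 / real N * (\<Sum>t = 1..int N. expectation (\<lambda>x. \<bar>U t x - Y t x\<bar>))"
        unfolding D_def[abs_def] by simp
      also have "\<dots> \<le> 1 / real N * (\<Sum>t = 1..int N. e / 4)"
        by (intro mult_left_mono sum_mono close) auto
      also have "\<dots> = e / 4" using N by simp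
      finally have D: "expectation D \<le> e / 4" .
      have pw: "\<bar>1 / real N * (\<Sum>t = 1..int N. U t x) - expectation (U 0)\<bar>
          \<le> D x + \<bar>A x\<bar> + \<bar>expectation (Y 0) - expectation (U 0)\<bar>" for x
      proof -
        have "\<bar>1 / real N * (\<Sum>t = 1..int N. U t x - Y t x)\<bar> \<le> D x"
          unfolding D_def abs_mult by (intro mult_mono sum_abs) auto
        moreover have "1 / real N * (\<Sum>t = 1..int N. U t x) - expectation (U 0) =
            1 / real N * (\<Sum>t = 1..int N. U t x - Y t x) + A x + (expectation (Y 0) - expectation (U 0))"
          by (simp add: A_def sum_subtractf right_diff_distrib)
        ultimately show ?thesis by linarith
      qed
      have "expectation (\<lambda>x. \<bar>1 / real N * (\<Sum>t = 1..int N. U t x) - expectation (U 0)\<bar>)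
          \<le> expectation (\<lambda>x. D x + \<bar>A x\<bar> + \<bar>expectation (Y 0) - expectation (U 0)\<bar>)"
        using pw by (intro integral_mono) (auto simp: D_def[abs_def] A_def[abs_def])
      also have "\<dots> = expectation D + expectation (\<lambda>x. \<bar>A x\<bar>) + \<bar>expectation (Y 0) - expectation (U 0)\<bar>"
        by (subst Bochner_Integration.integral_add | simp add: D_def[abs_def] A_def[abs_def] prob_space del: times_divide_eq_left)+
      also have "\<dots> < e"
        using D N0[OF N(1), folded A_def] diff[OF Y close, of 0] e by linarith
      finally show ?thesis .
    qed
    then show "\<exists>no. \<forall>N\<ge>no. norm (expectation (\<lambda>x. \<bar>1 / real N * (\<Sum>t = 1..int N. U t x)
        - expectation (U 0)\<bar>) - 0) < e"
      by (intro exI[of _ "max 1 N0"]) auto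
  qed
  with U mean show ?thesis by (simp add: ergodic_def)
qed

text \<open>The empirical autocovariance sums N - k terms but divides by N. For a nonnegative
  process the k missing terms have total expectation \<open>k * E (W 0)\<close>, which is negligible
  after division by N.\<close>

lemma ergodic_truncated_average:
  assumes W: "ergodic M W" and nn: "\<And>t x. 0 \<le> W t x"
  shows "(\<lambda>N. expectation (\<lambda>x. \<bar>1 / real N * (\<Sum>t = 1..int N - int k. W t x) - expectation (W 0)\<bar>)) \<longlonglongrightarrow> 0"
proof (rule tendsto_sandwich[where f = "\<lambda>_. 0"])
  note [simp] = ergodicD(1)[OF W]
  show "(\<lambda>N. expectation (\<lambda>x. \<bar>1 / real N * (\<Sum>t = 1..int N. W t x) - expectation (W 0)\<bar>)
      + 1 / real N * (real k * expectation (W 0))) \<longlonglongrightarrow> 0"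
    by (intro tendsto_add_zero ergodicD(3) W tendsto_mult_left_zero lim_1_over_n)
  show "\<forall>\<^sub>F N in sequentially.
     expectation (\<lambda>x. \<bar>1 / real N * (\<Sum>t = 1..int N - int k. W t x) - expectation (W 0)\<bar>)
      \<le> expectation (\<lambda>x. \<bar>1 / real N * (\<Sum>t = 1..int N. W t x) - expectation (W 0)\<bar>)
      + 1 / real N * (real k * expectation (W 0))"
    using eventually_ge_at_top[of k]
  proof eventually_elim
    case (elim N)
    have split: "(\<Sum>t = 1..int N. W t x) = (\<Sum>t = 1..int N - int k. W t x) + (\<Sum>t = int N - int k + 1..int N. W t x)" for x
      using elim by (subst sum.union_disjoint[symmetric]) (auto intro!: sum.cong)
    have "expectation (\<lambda>x. \<bar>1 / real N * (\<Sum>t = 1..int N - int k. W t x) - expectation (W 0)\<bar>)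
      \<le> expectation (\<lambda>x. \<bar>1 / real N * (\<Sum>t = 1..int N. W t x) - expectation (W 0)\<bar>
          + 1 / real N * (\<Sum>t = int N - int k + 1..int N. W t x))"
    proof (intro integral_mono)
      fix x
      have "0 \<le> 1 / real N * (\<Sum>t = int N - int k + 1..int N. W t x)"
        by (intro mult_nonneg_nonneg sum_nonneg nn) auto
      then show "\<bar>1 / real N * (\<Sum>t = 1..int N - int k. W t x) - expectation (W 0)\<bar>
        \<le> \<bar>1 / real N * (\<Sum>t = 1..int N. W t x) - expectation (W 0)\<bar>
          + 1 / real N * (\<Sum>t = int N - int k + 1..int N. W t x)"
        unfolding split[of x] by (simp only: distrib_left)
    qed auto
    also have "\<dots> = expectation (\<lambda>x. \<bar>1 / real N * (\<Sum>t = 1..int N. W t x) - expectation (W 0)\<bar>)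
        + expectation (\<lambda>x. 1 / real N * (\<Sum>t = int N - int k + 1..int N. W t x))"
      by (intro Bochner_Integration.integral_add) auto
    finally have le: "expectation (\<lambda>x. \<bar>1 / real N * (\<Sum>t = 1..int N - int k. W t x) - expectation (W 0)\<bar>)
      \<le> expectation (\<lambda>x. \<bar>1 / real N * (\<Sum>t = 1..int N. W t x) - expectation (W 0)\<bar>)
        + expectation (\<lambda>x. 1 / real N * (\<Sum>t = int N - int k + 1..int N. W t x))" .
    have "(\<Sum>t = int N - int k + 1..int N. expectation (W t)) =
        (\<Sum>t = int N - int k + 1..int N. expectation (W 0))"
      by (intro sum.cong refl ergodicD(2)[OF W])
    then have "expectation (\<lambda>x. 1 / real N * (\<Sum>t = int N - int k + 1..int N. W t x))
        = 1 / real N * (real k * expectation (W 0))"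
      using elim by simp
    with le show ?case by linarith
  qed
qed (auto intro!: always_eventually)

end

section \<open>Convergence in probability\<close>

text \<open>The principal root jumps across the negative real axis, so measurability comes from the
  explicit real and imaginary parts instead of continuity.\<close>

lemma csqrt_measurable [measurable]: "csqrt \<in> borel_measurable borel"
proof -
  have "csqrt z = of_real (sqrt ((cmod z + Re z) / 2)) +
      \<i> * of_real ((if Im z < 0 then - 1 else 1) * sqrt ((cmod z - Re z) / 2))" for z
    by (simp add: complex_eq_iff sgn_if)
  then show ?thesis by (simp add: fun_eq_iff[symmetric] cong: measurable_cong)
qed

context prob_space
begin

lemma converges_in_probability_L1:
  fixes Y :: "nat \<Rightarrow> 'a \<Rightarrow> real"
  assumes Y: "\<And>N. integrable M (Y N)"
    and lim: "(\<lambda>N. expectation (\<lambda>x. \<bar>Y N x - c\<bar>)) \<longlonglongrightarrow> 0"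
  shows "converges_in_probability M Y c"
  unfolding converges_in_probability_def
proof (intro conjI allI impI)
  fix \<delta> :: real assume \<delta>: "0 < \<delta>"
  note [measurable] = borel_measurable_integrable[OF Y]
  show "(\<lambda>N. measure M {\<omega> \<in> space M. \<delta> < dist (Y N \<omega>) c}) \<longlonglongrightarrow> 0"
  proof (rule tendsto_sandwich[where f = "\<lambda>_. 0"])
    show "(\<lambda>N. expectation (\<lambda>x. \<bar>Y N x - c\<bar>) / \<delta>) \<longlonglongrightarrow> 0"
      using tendsto_divide_zero[OF lim] .
    show "\<forall>\<^sub>F N in sequentially. measure M {\<omega> \<in> space M. \<delta> < dist (Y N \<omega>) c}
        \<le> expectation (\<lambda>x. \<bar>Y N x - c\<bar>) / \<delta>"
    proof (intro always_eventually allI)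
      fix N
      have "measure M {\<omega> \<in> space M. \<delta> < dist (Y N \<omega>) c} \<le> measure M {\<omega> \<in> space M. \<delta> \<le> \<bar>Y N \<omega> - c\<bar>}"
        by (intro finite_measure_mono) (auto simp: dist_real_def)
      also have "\<dots> \<le> expectation (\<lambda>x. \<bar>Y N x - c\<bar>) / \<delta>"
        using Y \<delta> by (intro integral_Markov_inequality_measure[where A = "space M"]) auto
      finally show "measure M {\<omega> \<in> space M. \<delta> < dist (Y N \<omega>) c}
        \<le> expectation (\<lambda>x. \<bar>Y N x - c\<bar>) / \<delta>" .
    qed
  qed auto
qed (use Y in auto)

lemma converges_in_probability_Pair:
  fixes Y :: "nat \<Rightarrow> 'a \<Rightarrow> 'b::{metric_space, second_countable_topology}"
    and Z :: "nat \<Rightarrow> 'a \<Rightarrow> 'c::{metric_space, second_countable_topology}"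
  assumes Y: "converges_in_probability M Y c" and Z: "converges_in_probability M Z d"
  shows "converges_in_probability M (\<lambda>N x. (Y N x, Z N x)) (c, d)"
  unfolding converges_in_probability_def
proof (intro conjI allI impI)
  have [measurable]: "Y N \<in> borel_measurable M" "Z N \<in> borel_measurable M" for N
    using Y Z by (auto simp: converges_in_probability_def)
  show "(\<lambda>x. (Y N x, Z N x)) \<in> borel_measurable M" for N
    by (intro borel_measurable_Pair) measurable
  fix \<delta> :: real assume \<delta>: "0 < \<delta>"
  show "(\<lambda>N. measure M {\<omega> \<in> space M. \<delta> < dist (Y N \<omega>, Z N \<omega>) (c, d)}) \<longlonglongrightarrow> 0"
  proof (rule tendsto_sandwich[where f = "\<lambda>_. 0"])
    show "(\<lambda>N. measure M {\<omega> \<in> space M. \<delta> / 2 < dist (Y N \<omega>) c} +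
        measure M {\<omega> \<in> space M. \<delta> / 2 < dist (Z N \<omega>) d}) \<longlonglongrightarrow> 0"
      using Y Z \<delta> unfolding converges_in_probability_def by (intro tendsto_add_zero) (blast intro: half_gt_zero)+
    show "\<forall>\<^sub>F N in sequentially. measure M {\<omega> \<in> space M. \<delta> < dist (Y N \<omega>, Z N \<omega>) (c, d)}
      \<le> measure M {\<omega> \<in> space M. \<delta> / 2 < dist (Y N \<omega>) c} +
        measure M {\<omega> \<in> space M. \<delta> / 2 < dist (Z N \<omega>) d}"
    proof (intro always_eventually allI order.trans[OF finite_measure_mono measure_Un_le])
      fix N
      have "dist (a, b) (c, d) \<le> dist a c + dist b d" for a b
        by (simp add: dist_Pair_Pair sqrt_sum_squares_le_sum)
      then show "{\<omega> \<in> space M. \<delta> < dist (Y N \<omega>, Z N \<omega>) (c, d)}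
        \<subseteq> {\<omega> \<in> space M. \<delta> / 2 < dist (Y N \<omega>) c} \<union> {\<omega> \<in> space M. \<delta> / 2 < dist (Z N \<omega>) d}"
        by (smt (verit) UnCI field_sum_of_halves mem_Collect_eq subsetI)
    qed auto
  qed auto
qed

text \<open>Continuity is asked for at the limit point alone, with Borel measurability elsewhere.
  This admits \<open>csqrt\<close> and the quotient with a default value, which are not continuous
  on their whole domain.\<close>

lemma converges_in_probability_continuous:
  fixes Y :: "nat \<Rightarrow> 'a \<Rightarrow> 'b::{metric_space, second_countable_topology}"
    and f :: "'b \<Rightarrow> 'c::{metric_space, second_countable_topology}"
  assumes Y: "converges_in_probability M Y c"
    and f[measurable]: "f \<in> borel_measurable borel" and cont: "isCont f c"
  shows "converges_in_probability M (\<lambda>N x. f (Y N x)) (f c)"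
  unfolding converges_in_probability_def
proof (intro conjI allI impI)
  have [measurable]: "Y N \<in> borel_measurable M" for N
    using Y by (auto simp: converges_in_probability_def)
  show "(\<lambda>x. f (Y N x)) \<in> borel_measurable M" for N
    by measurable
  fix \<delta> :: real assume \<delta>: "0 < \<delta>"
  then obtain e where e: "0 < e" "\<And>y. dist y c < e \<Longrightarrow> dist (f y) (f c) < \<delta>"
    using cont unfolding continuous_at_eps_delta by blast
  show "(\<lambda>N. measure M {\<omega> \<in> space M. \<delta> < dist (f (Y N \<omega>)) (f c)}) \<longlonglongrightarrow> 0"
  proof (rule tendsto_sandwich[where f = "\<lambda>_. 0"])
    \<comment> \<open>The events are defined by a strict inequality; with radius e / 2, the
      complement satisfies \<open>dist \<le> e / 2 < e\<close>, where continuity applies.\<close>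
    show "(\<lambda>N. measure M {\<omega> \<in> space M. e / 2 < dist (Y N \<omega>) c}) \<longlonglongrightarrow> 0"
      using Y e(1) unfolding converges_in_probability_def by (blast intro: half_gt_zero)
    show "\<forall>\<^sub>F N in sequentially. measure M {\<omega> \<in> space M. \<delta> < dist (f (Y N \<omega>)) (f c)}
      \<le> measure M {\<omega> \<in> space M. e / 2 < dist (Y N \<omega>) c}"
    proof (intro always_eventually allI finite_measure_mono)
      fix N
      show "{\<omega> \<in> space M. \<delta> < dist (f (Y N \<omega>)) (f c)} \<subseteq> {\<omega> \<in> space M. e / 2 < dist (Y N \<omega>) c}"
        using e(1) e(2) by (smt (verit) Collect_mono_iff field_sum_of_halves)
    qed measurable
  qed auto
qed

lemma converges_in_probability_const:
  fixes c :: "'b::{metric_space, second_countable_topology}"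
  shows "converges_in_probability M (\<lambda>N x. c) c"
  by (simp add: converges_in_probability_def)

lemma converges_in_probability_deterministic:
  fixes y :: "nat \<Rightarrow> real"
  assumes "y \<longlonglongrightarrow> c"
  shows "converges_in_probability M (\<lambda>N x. y N) c"
  using tendsto_rabs_zero[OF LIM_zero[OF assms]]
  by (intro converges_in_probability_L1) (simp_all add: prob_space)

lemma
  fixes Y Z :: "nat \<Rightarrow> 'a \<Rightarrow> 'b::{real_normed_algebra, second_countable_topology}"
  assumes "converges_in_probability M Y c" "converges_in_probability M Z d"
  shows converges_in_probability_add: "converges_in_probability M (\<lambda>N x. Y N x + Z N x) (c + d)"
    and converges_in_probability_diff: "converges_in_probability M (\<lambda>N x. Y N x - Z N x) (c - d)"
    and converges_in_probability_mult: "converges_in_probability M (\<lambda>N x. Y N x * Z N x) (c * d)"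
proof -
  note P = converges_in_probability_continuous[OF converges_in_probability_Pair[OF assms]]
  have meas: "(\<lambda>p. fst p + snd p :: 'b) \<in> borel_measurable borel" "(\<lambda>p. fst p - snd p :: 'b) \<in> borel_measurable borel"
    "(\<lambda>p. fst p * snd p :: 'b) \<in> borel_measurable borel"
    by (intro borel_measurable_continuous_onI continuous_intros)+
  have cont: "isCont (\<lambda>p. fst p + snd p) (c, d)" "isCont (\<lambda>p. fst p - snd p) (c, d)"
    "isCont (\<lambda>p. fst p * snd p) (c, d)"
    by (intro continuous_intros)+
  show "converges_in_probability M (\<lambda>N x. Y N x + Z N x) (c + d)"
    using P[OF meas(1) cont(1)] by (simp only: fst_conv snd_conv)
  show "converges_in_probability M (\<lambda>N x. Y N x - Z N x) (c - d)"
    using P[OF meas(2) cont(2)] by (simp only: fst_conv snd_conv)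
  show "converges_in_probability M (\<lambda>N x. Y N x * Z N x) (c * d)"
    using P[OF meas(3) cont(3)] by (simp only: fst_conv snd_conv)
qed

lemma converges_in_probability_complex_of_real:
  "converges_in_probability M Y c \<Longrightarrow> converges_in_probability M (\<lambda>N x. complex_of_real (Y N x)) (of_real c)"
  by (rule converges_in_probability_continuous[where f = complex_of_real]) simp_all

text \<open>A positive limit stays off the branch cut of the root, whatever complex values Y takes
  before the limit.\<close>

lemma converges_in_probability_csqrt:
  assumes Y: "converges_in_probability M Y (of_real c)" and c: "0 < c"
  shows "converges_in_probability M (\<lambda>N x. csqrt (Y N x)) (of_real (sqrt c))"
proof -
  have "complex_of_real c \<notin> \<real>\<^sub>\<le>\<^sub>0" using c by simp
  from converges_in_probability_continuous[OF Y csqrt_measurable continuous_at_csqrt[OF this]]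
  show ?thesis using c by (simp only: of_real_sqrt less_imp_le)
qed

text \<open>The default d is used only on the closed set where the second coordinate is 0. A
  neighbourhood of \<open>(z, a)\<close> avoids this set, and there the function is an ordinary
  quotient.\<close>

lemma converges_in_probability_divide:
  fixes Z :: "nat \<Rightarrow> 'a \<Rightarrow> complex" and A :: "nat \<Rightarrow> 'a \<Rightarrow> real"
  assumes Z: "converges_in_probability M Z z" and A: "converges_in_probability M A a" and a: "a \<noteq> 0"
  shows "converges_in_probability M (\<lambda>N x. if A N x = 0 then d else Z N x / of_real (2 * A N x)) (z / of_real (2 * a))"
proof -
  define f where "f p = (if snd p = 0 then d else fst p / complex_of_real (2 * snd p))" for p
  have meas: "f \<in> borel_measurable borel"
    unfolding f_def[abs_def] borel_prod[symmetric] by measurable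
  have "open {p :: complex \<times> real. snd p \<noteq> 0}"
    by (intro open_Collect_neq continuous_intros)
  then have "\<forall>\<^sub>F p in nhds (z, a). f p = fst p / complex_of_real (2 * snd p)"
    using a by (auto simp: f_def eventually_nhds intro!: exI[of _ "{p. snd p \<noteq> 0}"])
  then have "isCont f (z, a) \<longleftrightarrow> isCont (\<lambda>p. fst p / complex_of_real (2 * snd p)) (z, a)"
    by (rule isCont_cong)
  moreover have "isCont (\<lambda>p. fst p / complex_of_real (2 * snd p)) (z, a)"
    using a by (intro continuous_intros) simp
  ultimately have "isCont f (z, a)" by simp
  from converges_in_probability_continuous[OF converges_in_probability_Pair[OF Z A] meas this]
  show ?thesis using a by (simp only: f_def fst_conv snd_conv if_False)
qed

lemma ergodic_converges_in_probability:
  assumes W: "ergodic M W" and nn: "\<And>t x. 0 \<le> W t x"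
  shows "converges_in_probability M (\<lambda>N x. 1 / real N * (\<Sum>t = 1..int N - int k. W t x)) (expectation (W 0))"
  using ergodicD(1)[OF W]
  by (intro converges_in_probability_L1 ergodic_truncated_average assms) simp

end

section \<open>Monomials in the noise and the liquidity\<close>

text \<open>A list of times with repetitions encodes the exponents: products become concatenations,
  time shifts become maps, and degrees become counts or lengths.\<close>

definition mon :: "(int \<Rightarrow> 'a \<Rightarrow> real) \<Rightarrow> int list \<Rightarrow> 'a \<Rightarrow> real" where
  "mon Z as \<omega> = (\<Prod>a\<leftarrow>as. Z a \<omega>)"

abbreviation shift :: "int \<Rightarrow> int list \<Rightarrow> int list" where
  "shift t \<equiv> map ((+) t)"

lemma mon_simps [simp]:
  "mon Z [] \<omega> = 1" "mon Z (a # as) \<omega> = Z a \<omega> * mon Z as \<omega>"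
  "mon Z (as @ bs) \<omega> = mon Z as \<omega> * mon Z bs \<omega>"
  by (simp_all add: mon_def)

lemma mon_replicate [simp]: "mon Z (replicate p a) \<omega> = Z a \<omega> ^ p"
  by (induction p) simp_all

lemma mon_abs_simps:
  "mon Z [] = (\<lambda>\<omega>. 1)" "mon Z (a # as) = (\<lambda>\<omega>. Z a \<omega> * mon Z as \<omega>)"
  "mon Z (as @ bs) = (\<lambda>\<omega>. mon Z as \<omega> * mon Z bs \<omega>)"
  "mon Z (replicate p a) = (\<lambda>\<omega>. Z a \<omega> ^ p)"
  by (simp_all add: fun_eq_iff)

lemma shift_shift: "shift s (shift t as) = shift (s + t) as"
  by (simp add: comp_def add.assoc)

lemma shift_0 [simp]: "shift 0 as = as"
  by (simp add: map_idI)

lemma inj_shift: "inj ((+) (t::int))"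
  by (simp add: inj_def)

lemma count_list_shift: "count_list (shift t as) a = count_list as (a - t)"
  using count_list_map_conv[OF inj_shift, of t as "a - t"] by simp

lemma count_list_replicate: "count_list (replicate p a) b = (if a = b then p else 0)"
  by (induction p) auto

text \<open>Grouping equal times leaves factors at distinct times, to which independence of the
  noise applies.\<close>

lemma mon_eq_prod_count: "mon Z as \<omega> = (\<Prod>a\<in>set as. Z a \<omega> ^ count_list as a)"
proof (induction as)
  case (Cons a as)
  show ?case
  proof (cases "a \<in> set as")
    case True
    have "(\<Prod>b\<in>set as. Z b \<omega> ^ count_list (a # as) b) =
        Z a \<omega> ^ Suc (count_list as a) * (\<Prod>b\<in>set as - {a}. Z b \<omega> ^ count_list as b)"
      using True by (subst prod.remove[of _ a]) (auto intro!: prod.cong)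
    also have "\<dots> = Z a \<omega> * (\<Prod>b\<in>set as. Z b \<omega> ^ count_list as b)"
      using True by (subst (2) prod.remove[of _ a]) auto
    finally show ?thesis using Cons True by (simp add: insert_absorb)
  next
    case False
    then have "(\<Prod>b\<in>set as. Z b \<omega> ^ count_list (a # as) b) = (\<Prod>b\<in>set as. Z b \<omega> ^ count_list as b)"
      by (intro prod.cong) auto
    then show ?thesis using Cons False by (simp add: count_list_0_iff)
  qed
qed simp

lemma abs_power_le_one_plus:
  fixes x :: real
  assumes "p \<le> q" "even q"
  shows "\<bar>x ^ p\<bar> \<le> 1 + x ^ q"
proof (cases "\<bar>x\<bar> \<le> 1")
  case True
  then have "\<bar>x ^ p\<bar> \<le> 1" by (simp add: power_abs power_le_one)
  moreover have "0 \<le> x ^ q" using assms(2) by (rule zero_le_even_power)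
  ultimately show ?thesis by linarith
next
  case False
  then have "\<bar>x\<bar> ^ p \<le> \<bar>x\<bar> ^ q" using assms(1) by (intro power_increasing) auto
  also have "\<dots> = x ^ q" using assms(2) by (rule power_even_abs)
  finally show ?thesis by (simp add: power_abs)
qed

text \<open>An elementary replacement for Hoelder's inequality: the product is at most a power of
  the largest absolute value m, and \<open>m ^ q\<close> occurs among the summands because q is
  even.\<close>

lemma abs_prod_list_le:
  fixes xs :: "real list"
  assumes "length xs \<le> q" "even q"
  shows "\<bar>prod_list xs\<bar> \<le> 1 + (\<Sum>x\<leftarrow>xs. x ^ q)"
proof (cases "xs = []")
  case False
  define m where "m = Max (abs ` set xs)"
  have fin: "finite (abs ` set xs)" "abs ` set xs \<noteq> {}" using False by auto
  have "m \<in> abs ` set xs" unfolding m_def using fin by (rule Max_in)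
  then obtain y where y: "y \<in> set xs" "m = \<bar>y\<bar>" by blast
  have m: "\<bar>x\<bar> \<le> m" if "x \<in> set xs" for x
    unfolding m_def using that by (intro Max_ge) auto
  have "\<bar>prod_list xs\<bar> \<le> m ^ length xs"
    using m
  proof (induction xs)
    case (Cons a xs)
    have "0 \<le> m" using Cons.prems[of a] by simp
    with Cons show ?case by (auto simp: abs_mult intro!: mult_mono)
  qed simp
  also have "\<dots> \<le> 1 + m ^ q"
    using abs_power_le_one_plus[OF assms, of m] by simp
  also have "m ^ q = y ^ q" using assms(2) y by (simp add: power_even_abs)
  also have "y ^ q \<le> (\<Sum>x\<leftarrow>xs. x ^ q)"
    using y(1) assms(2) by (intro member_le_sum_list) (auto simp: zero_le_even_power)
  finally show ?thesis by simp
qed (use assms in simp)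

locale generalized_arch_mixing = generalized_arch +
  assumes L_moment: "integrable M (\<lambda>\<omega>. L 0 \<omega> ^ 4)"
    and eps_moment: "integrable M (\<lambda>\<omega>. \<epsilon> 0 \<omega> ^ 8)"
    and alpha1_less: "\<alpha>\<^sub>1 < 1 / root 4 (expectation (\<lambda>\<omega>. \<epsilon> 0 \<omega> ^ 8))"
    and mixing1: "((\<lambda>t. cov M (L 0) (L t)) \<longlongrightarrow> 0) at_top"
    and mixing2_pos: "\<And>m. ((\<lambda>t. cov M (\<lambda>\<omega>. L 0 \<omega> * L m \<omega>) (L t)) \<longlongrightarrow> 0) at_top"
    and mixing2_neg: "\<And>m. ((\<lambda>t. cov M (\<lambda>\<omega>. L 0 \<omega> * L m \<omega>) (L (- t))) \<longlongrightarrow> 0) at_top"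
    and mixing3: "\<And>m\<^sub>1 m\<^sub>2. ((\<lambda>t. cov M (\<lambda>\<omega>. L 0 \<omega> * L m\<^sub>1 \<omega>) (\<lambda>\<omega>. L t \<omega> * L (t + m\<^sub>2) \<omega>)) \<longlongrightarrow> 0) at_top"
begin

section \<open>Moments of noise and liquidity monomials\<close>

lemma noise_measurable [measurable]: "\<epsilon> t \<in> borel_measurable M"
  using noise_indep by (auto simp: indep_vars_def)

lemma liquidity_measurable [measurable]: "L t \<in> borel_measurable M"
  using liquidity_stationary by (auto simp: strictly_stationary_def)

lemma mon_measurable [measurable]:
  "mon \<epsilon> es \<in> borel_measurable M" "mon L ls \<in> borel_measurable M"
proof -
  have "(\<lambda>\<omega>. \<Prod>a\<leftarrow>as. Z a \<omega>) \<in> borel_measurable M" if "\<And>a. Z a \<in> borel_measurable M"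
    for as and Z :: "int \<Rightarrow> 'a \<Rightarrow> real"
    using that by (induction as) auto
  then show "mon \<epsilon> es \<in> borel_measurable M" "mon L ls \<in> borel_measurable M"
    by (simp_all add: mon_def[abs_def])
qed

definition noise_moment :: "nat \<Rightarrow> real" where
  "noise_moment p = expectation (\<lambda>\<omega>. \<epsilon> 0 \<omega> ^ p)"

lemma noise_power:
  assumes "p \<le> 8"
  shows "integrable M (\<lambda>\<omega>. \<epsilon> t \<omega> ^ p)" "expectation (\<lambda>\<omega>. \<epsilon> t \<omega> ^ p) = noise_moment p"
proof -
  have 0: "integrable M (\<lambda>\<omega>. \<epsilon> 0 \<omega> ^ p)"
  proof (rule Bochner_Integration.integrable_bound)
    show "integrable M (\<lambda>\<omega>. 1 + \<epsilon> 0 \<omega> ^ 8)" using eps_moment by simp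
    show "AE \<omega> in M. norm (\<epsilon> 0 \<omega> ^ p) \<le> norm (1 + \<epsilon> 0 \<omega> ^ 8)"
      using abs_power_le_one_plus[OF assms] by (auto intro!: AE_I2 order.trans[OF _ abs_ge_self])
  qed simp
  have "integrable (distr M borel (\<epsilon> s)) (\<lambda>x. x ^ p) \<longleftrightarrow> integrable M (\<lambda>\<omega>. \<epsilon> s \<omega> ^ p)" for s
    by (intro integrable_distr_eq) auto
  with 0 show "integrable M (\<lambda>\<omega>. \<epsilon> t \<omega> ^ p)"
    by (metis noise_ident)
  have "integral\<^sup>L (distr M borel (\<epsilon> s)) (\<lambda>x. x ^ p) = expectation (\<lambda>\<omega>. \<epsilon> s \<omega> ^ p)" for s
    by (intro integral_distr) auto
  then show "expectation (\<lambda>\<omega>. \<epsilon> t \<omega> ^ p) = noise_moment p"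
    unfolding noise_moment_def by (metis noise_ident)
qed

lemma
  assumes "\<And>a. count_list es a \<le> 8"
  shows integrable_mon_noise: "integrable M (mon \<epsilon> es)"
    and expectation_mon_noise: "expectation (mon \<epsilon> es) = (\<Prod>a\<in>set es. noise_moment (count_list es a))"
proof -
  have eq: "mon \<epsilon> es = (\<lambda>\<omega>. \<Prod>a\<in>set es. \<epsilon> a \<omega> ^ count_list es a)"
    by (rule ext) (rule mon_eq_prod_count)
  have ind: "indep_vars (\<lambda>_. borel) (\<lambda>a \<omega>. \<epsilon> a \<omega> ^ count_list es a) (set es)"
    by (rule indep_vars_compose2[OF indep_vars_subset[OF noise_indep], where Y = "\<lambda>a x. x ^ count_list es a"]) auto
  show "integrable M (mon \<epsilon> es)"
    unfolding eq by (intro indep_vars_integrable ind noise_power assms) simp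
  show "expectation (mon \<epsilon> es) = (\<Prod>a\<in>set es. noise_moment (count_list es a))"
    unfolding eq using noise_power[OF assms]
    by (subst indep_vars_lebesgue_integral[OF _ ind]) simp_all
qed

lemma expectation_mon_noise_shift:
  assumes "\<And>a. count_list es a \<le> 8"
  shows "expectation (mon \<epsilon> (shift t es)) = expectation (mon \<epsilon> es)"
proof -
  have "count_list (shift t es) a \<le> 8" for a
    using assms by (simp add: count_list_shift)
  then show ?thesis
    using assms
    by (simp add: expectation_mon_noise prod.reindex inj_shift[THEN inj_on_subset] count_list_shift del: set_map)
      (simp add: prod.reindex inj_shift[THEN inj_on_subset] count_list_shift)
qed

text \<open>When no time is shared, every exponent in the concatenation comes from one of the two
  lists, so the product formula for the moments splits.\<close>

lemma expectation_mon_noise_append: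
  assumes "\<And>a. count_list es a \<le> 8" "\<And>a. count_list fs a \<le> 8" "set es \<inter> set fs = {}"
  shows "expectation (mon \<epsilon> (es @ fs)) = expectation (mon \<epsilon> es) * expectation (mon \<epsilon> fs)"
proof -
  have "count_list (es @ fs) a \<le> 8" for a
  proof (cases "a \<in> set es")
    case True
    then have "count_list fs a = 0" using assms(3) by (auto simp: count_list_0_iff)
    then show ?thesis using assms(1) by simp
  qed (use assms(2) in simp)
  then have "expectation (mon \<epsilon> (es @ fs)) =
      (\<Prod>a\<in>set es. noise_moment (count_list (es @ fs) a)) * (\<Prod>a\<in>set fs. noise_moment (count_list (es @ fs) a))"
    using assms by (simp add: expectation_mon_noise prod.union_disjoint del: count_list_append)
  moreover have "(\<Prod>a\<in>set es. noise_moment (count_list (es @ fs) a)) = expectation (mon \<epsilon> es)"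
    unfolding expectation_mon_noise[OF assms(1)] using assms(3)
    by (intro prod.cong refl) (auto simp: disjoint_iff)
  moreover have "(\<Prod>a\<in>set fs. noise_moment (count_list (es @ fs) a)) = expectation (mon \<epsilon> fs)"
    unfolding expectation_mon_noise[OF assms(2)]
  proof (intro prod.cong refl)
    fix a assume "a \<in> set fs"
    then have "count_list es a = 0" using assms(3) by (auto simp: count_list_0_iff)
    then show "noise_moment (count_list (es @ fs) a) = noise_moment (count_list fs a)" by simp
  qed
  ultimately show ?thesis by simp
qed

text \<open>Every shift of the monomial is one and the same measurable function g of the vector of
  the \<open>L (a + s)\<close> with a in the finite set of times, and by strict stationarity the law
  of this vector does not depend on s.\<close>

lemma
  shows integrable_mon_liquidity_shift: "integrable M (mon L (shift t ls)) \<longleftrightarrow> integrable M (mon L ls)"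
    and expectation_mon_liquidity_shift: "expectation (mon L (shift t ls)) = expectation (mon L ls)"
proof -
  define P where "P = (\<Pi>\<^sub>M a\<in>set ls. (borel :: real measure))"
  define g where "g x = (\<Prod>a\<leftarrow>ls. x a :: real)" for x
  have g: "g \<in> borel_measurable P"
  proof -
    have "(\<lambda>x. \<Prod>a\<leftarrow>as. x a) \<in> borel_measurable P" if "set as \<subseteq> set ls" for as
      using that by (induction as) (auto simp: P_def)
    then show ?thesis unfolding g_def[abs_def] by blast
  qed
  have r: "(\<lambda>\<omega>. \<lambda>a\<in>set ls. L (a + s) \<omega>) \<in> measurable M P" for s
    unfolding P_def by (intro measurable_restrict) auto
  have eq: "mon L (shift s ls) = (\<lambda>\<omega>. g (\<lambda>a\<in>set ls. L (a + s) \<omega>))" for s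
    unfolding mon_def g_def map_map comp_def
    by (intro ext arg_cong[where f = prod_list] map_cong refl) (auto simp: add.commute)
  have d: "distr M P (\<lambda>\<omega>. \<lambda>a\<in>set ls. L (a + t) \<omega>) = distr M P (\<lambda>\<omega>. \<lambda>a\<in>set ls. L (a + 0) \<omega>)"
    using liquidity_stationary unfolding strictly_stationary_def P_def by simp
  have "integrable M (mon L (shift t ls)) \<longleftrightarrow> integrable M (mon L (shift 0 ls))"
    unfolding eq integrable_distr_eq[OF r g, symmetric] d ..
  then show "integrable M (mon L (shift t ls)) \<longleftrightarrow> integrable M (mon L ls)" by simp
  have "expectation (mon L (shift t ls)) = expectation (mon L (shift 0 ls))"
    unfolding eq integral_distr[OF r g, symmetric] d ..
  then show "expectation (mon L (shift t ls)) = expectation (mon L ls)" by simp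
qed

lemma integrable_mon_liquidity:
  assumes "length ls \<le> 4"
  shows "integrable M (mon L ls)"
proof (rule Bochner_Integration.integrable_bound)
  have four: "integrable M (\<lambda>\<omega>. L a \<omega> ^ 4)" for a
  proof -
    have "integrable M (mon L (replicate 4 0))"
      using L_moment by (simp only: mon_abs_simps)
    then have "integrable M (mon L (shift a (replicate 4 0)))"
      by (simp only: integrable_mon_liquidity_shift)
    then show ?thesis by (simp add: mon_abs_simps)
  qed
  have "integrable M (\<lambda>\<omega>. \<Sum>a\<leftarrow>as. L a \<omega> ^ 4)" for as
    by (induction as) (auto simp: four)
  then show "integrable M (\<lambda>\<omega>. 1 + (\<Sum>a\<leftarrow>ls. L a \<omega> ^ 4))" by simp
  show "AE \<omega> in M. norm (mon L ls \<omega>) \<le> norm (1 + (\<Sum>a\<leftarrow>ls. L a \<omega> ^ 4))"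
  proof (intro AE_I2)
    fix \<omega>
    have "\<bar>mon L ls \<omega>\<bar> \<le> 1 + (\<Sum>a\<leftarrow>ls. L a \<omega> ^ 4)"
      using abs_prod_list_le[of "map (\<lambda>a. L a \<omega>) ls" 4] assms by (simp add: mon_def comp_def)
    then show "norm (mon L ls \<omega>) \<le> norm (1 + (\<Sum>a\<leftarrow>ls. L a \<omega> ^ 4))" by simp
  qed
qed simp

lemma cov_mon_liquidity:
  assumes "length as \<le> 2" "length bs \<le> 2"
  shows "cov M (mon L as) (mon L bs) = expectation (mon L (as @ bs)) - expectation (mon L as) * expectation (mon L bs)"
proof -
  have [simp]: "integrable M (mon L as)" "integrable M (mon L bs)"
    "integrable M (\<lambda>\<omega>. mon L as \<omega> * mon L bs \<omega>)"
    using integrable_mon_liquidity[of as] integrable_mon_liquidity[of bs]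
      integrable_mon_liquidity[of "as @ bs"] assms by (simp_all add: mon_abs_simps)
  have "expectation (\<lambda>\<omega>. mon L as \<omega> * mon L bs \<omega>) = expectation (mon L (as @ bs))"
    by (simp add: mon_abs_simps)
  then show ?thesis
    by (simp add: cov_def algebra_simps prob_space)
qed

text \<open>After a shift that moves the first factor to time \<open>0\<close>, each pair of nonempty lists is one of the
  mixing hypotheses; for \<open>as = [a]\<close> and \<open>bs = [b, b']\<close> it is the block at time \<open>t\<close> that is moved to \<open>0\<close>.\<close>

lemma liquidity_mixing:
  assumes "length as \<le> 2" "length bs \<le> 2"
  shows "((\<lambda>t. expectation (mon L (as @ shift t bs))) \<longlongrightarrow> expectation (mon L as) * expectation (mon L bs)) at_top"
proof -
  have lim: "filterlim (\<lambda>t::int. t + c) at_top at_top" for c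
    unfolding filterlim_at_top eventually_at_top_linorder
    by (metis add.commute add_le_cancel_left diff_add_cancel)
  have "((\<lambda>t. cov M (mon L as) (mon L (shift t bs))) \<longlongrightarrow> 0) at_top"
  proof -
    have sh: "cov M (mon L as) (mon L (shift t bs)) = cov M (mon L (shift s as)) (mon L (shift (s + t) bs))" for s t
    proof -
      have "expectation (mon L (shift s (as @ shift t bs))) = expectation (mon L (as @ shift t bs))"
        by (rule expectation_mon_liquidity_shift)
      moreover have "shift s (as @ shift t bs) = shift s as @ shift (s + t) bs"
        by (simp only: map_append shift_shift)
      ultimately show ?thesis
        using assms by (simp only: cov_mon_liquidity length_map expectation_mon_liquidity_shift)
    qed
    have fun1: "mon L [a] = L a" "mon L [a, b] = (\<lambda>\<omega>. L a \<omega> * L b \<omega>)" for a b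
      by (simp_all add: fun_eq_iff)
    have nil: "cov M (mon L []) U = 0" "cov M U (mon L []) = 0" for U
      by (simp_all add: cov_def prob_space mon_abs_simps)
    have swap: "cov M U V = cov M V U" for U V
      by (simp add: cov_def mult.commute)
    consider "as = []" | "bs = []" | a b where "as = [a]" "bs = [b]"
      | a a' b where "as = [a, a']" "bs = [b]" | a b b' where "as = [a]" "bs = [b, b']"
      | a a' b b' where "as = [a, a']" "bs = [b, b']"
      using assms by (auto simp: length_Suc_conv numeral_2_eq_2 le_Suc_eq)
    then show ?thesis
    proof cases
      case 1 then show ?thesis by (simp add: nil)
    next
      case 2 then show ?thesis by (simp add: nil)
    next
      case (3 a b)
      have "cov M (mon L as) (mon L (shift t bs)) = cov M (L 0) (L (t + (b - a)))" for t
        unfolding sh[of t "-a"] unfolding 3 by (simp add: fun1 algebra_simps)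
      then show ?thesis
        by (simp only:) (rule filterlim_compose[OF mixing1 lim])
    next
      case (4 a a' b)
      have "cov M (mon L as) (mon L (shift t bs)) = cov M (\<lambda>\<omega>. L 0 \<omega> * L (a' - a) \<omega>) (L (t + (b - a)))" for t
        unfolding sh[of t "-a"] unfolding 4 by (simp add: fun1 algebra_simps)
      then show ?thesis
        by (simp only:) (rule filterlim_compose[OF mixing2_pos lim])
    next
      case (5 a b b')
      have "cov M (mon L as) (mon L (shift t bs)) = cov M (\<lambda>\<omega>. L 0 \<omega> * L (b' - b) \<omega>) (L (- (t + (b - a))))" for t
        unfolding sh[of t "-(t + b)"] unfolding 5 by (subst swap) (simp add: fun1 algebra_simps)
      then show ?thesis
        by (simp only:) (rule filterlim_compose[OF mixing2_neg lim])
    next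
      case (6 a a' b b')
      have "cov M (mon L as) (mon L (shift t bs)) =
          cov M (\<lambda>\<omega>. L 0 \<omega> * L (a' - a) \<omega>) (\<lambda>\<omega>. L (t + (b - a)) \<omega> * L (t + (b - a) + (b' - b)) \<omega>)" for t
        unfolding sh[of t "-a"] unfolding 6 by (simp add: fun1 algebra_simps)
      then show ?thesis
        by (simp only:) (rule filterlim_compose[OF mixing3 lim])
    qed
  qed
  then have "((\<lambda>t. cov M (mon L as) (mon L (shift t bs)) + expectation (mon L as) * expectation (mon L bs))
      \<longlongrightarrow> 0 + expectation (mon L as) * expectation (mon L bs)) at_top"
    by (intro tendsto_intros)
  then show ?thesis
    using assms by (simp add: cov_mon_liquidity expectation_mon_liquidity_shift del: mon_simps)
qed

definition cross :: "int list \<Rightarrow> int list \<Rightarrow> 'a \<Rightarrow> real" where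
  "cross es ls \<omega> = mon \<epsilon> es \<omega> * mon L ls \<omega>"

lemma cross_mult: "cross es ls \<omega> * cross fs ks \<omega> = cross (es @ fs) (ls @ ks) \<omega>"
  by (simp add: cross_def)

lemma cross_measurable [measurable]: "cross es ls \<in> borel_measurable M"
  unfolding cross_def by measurable

text \<open>The independence hypothesis concerns the two entire paths; a monomial is a measurable
  function of a path, so the liquidity factor and the noise factor are independent.\<close>

lemma
  assumes "\<And>a. count_list es a \<le> 8" "length ls \<le> 4"
  shows integrable_cross: "integrable M (cross es ls)"
    and expectation_cross: "expectation (cross es ls) = expectation (mon \<epsilon> es) * expectation (mon L ls)"
proof -
  have g: "(\<lambda>x. \<Prod>a\<leftarrow>as. x a :: real) \<in> borel_measurable (\<Pi>\<^sub>M t\<in>UNIV. borel)" for as :: "int list"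
    by (induction as) auto
  have "indep_var borel (mon L ls) borel (mon \<epsilon> es)"
    using indep_var_compose[OF liquidity_noise_indep g g, of ls es] by (simp add: comp_def mon_def[abs_def])
  note ind = indep_var_integrable[OF this] indep_var_lebesgue_integral[OF this]
  show "integrable M (cross es ls)"
    using ind(1) integrable_mon_noise integrable_mon_liquidity assms
    by (simp add: cross_def[abs_def] mult.commute)
  show "expectation (cross es ls) = expectation (mon \<epsilon> es) * expectation (mon L ls)"
    using ind(2) integrable_mon_noise integrable_mon_liquidity assms
    by (simp add: cross_def[abs_def] mult.commute)
qed

text \<open>Squaring doubles the list, so the admissible degrees are half of those for
  integrability: 4 instead of 8 per noise variable and 2 instead of 4 for the liquidity.\<close>

lemma sq_integrable_cross:
  assumes "\<And>a. count_list es a \<le> 4" "length ls \<le> 2"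
  shows "sq_integrable M (cross es ls)"
proof -
  have "count_list (es @ es) a \<le> 8" for a
    using assms(1)[of a] by simp
  then have "integrable M (cross (es @ es) (ls @ ls))"
    using assms(2) by (intro integrable_cross) auto
  then show ?thesis
    by (simp add: sq_integrable_def power2_eq_square cross_mult)
qed

lemma expectation_cross_shift:
  assumes "\<And>a. count_list es a \<le> 8" "length ls \<le> 4"
  shows "expectation (cross (shift t es) (shift t ls)) = expectation (cross es ls)"
proof -
  have "count_list (shift t es) a \<le> 8" for a
    using assms by (simp add: count_list_shift)
  then show ?thesis
    using assms by (simp add: expectation_cross expectation_mon_noise_shift expectation_mon_liquidity_shift)
qed

text \<open>The product at lag h is again a monomial. For large h its noise part factorises exactly,
  since the two blocks of times are disjoint, while its liquidity part factorises only in the limit,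
  by mixing.\<close>

lemma ergodic_cross:
  assumes es: "\<And>a. count_list es a \<le> 4" and ls: "length ls \<le> 2"
  shows "ergodic M (\<lambda>t. cross (shift t es) (shift t ls))"
proof (rule ergodic_if_cov_null)
  have es8: "count_list es a \<le> 8" for a
    using es[of a] by simp
  have es4: "count_list (shift t es) a \<le> 4" for t a
    using es by (simp add: count_list_shift)
  show "sq_integrable M (cross (shift t es) (shift t ls))" for t
    using es4 ls by (intro sq_integrable_cross) auto
  show "expectation (cross (shift t es) (shift t ls)) = expectation (cross es ls)" for t
    using es8 ls by (intro expectation_cross_shift) auto
  let ?e = "\<lambda>h. es @ shift (int h) es" and ?l = "\<lambda>h. ls @ shift (int h) ls"
  have cnt: "count_list (?e h) a \<le> 8" for h a
    using es[of a] es4[of "int h" a] by simp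
  show "expectation (\<lambda>\<omega>. cross (shift s es) (shift s ls) \<omega> * cross (shift (s + int h) es) (shift (s + int h) ls) \<omega>)
      = expectation (cross (?e h) (?l h))" for s h
  proof -
    have "(\<lambda>\<omega>. cross (shift s es) (shift s ls) \<omega> * cross (shift (s + int h) es) (shift (s + int h) ls) \<omega>)
        = cross (shift s (?e h)) (shift s (?l h))"
      by (simp only: cross_mult map_append shift_shift fun_eq_iff simp_thms)
    then show ?thesis
      using cnt ls by (simp only: expectation_cross_shift[OF cnt] length_append length_map)
  qed
  show "(\<lambda>h. expectation (cross (?e h) (?l h))) \<longlonglongrightarrow> (expectation (cross es ls))\<^sup>2"
  proof -
    have "(\<lambda>h. (expectation (mon \<epsilon> es) * expectation (mon \<epsilon> es)) * expectation (mon L (?l h)))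
        \<longlonglongrightarrow> (expectation (mon \<epsilon> es) * expectation (mon \<epsilon> es)) * (expectation (mon L ls) * expectation (mon L ls))"
      using ls by (intro tendsto_intros filterlim_compose[OF liquidity_mixing filterlim_int_sequentially])
    moreover have "eventually (\<lambda>h. expectation (cross (?e h) (?l h)) =
        (expectation (mon \<epsilon> es) * expectation (mon \<epsilon> es)) * expectation (mon L (?l h))) sequentially"
    proof -
      \<comment> \<open>All noise times lie in [-b, b], so a shift by at least 2 b + 1 separates
        them from their image.\<close>
      obtain b :: int where b: "\<And>a. a \<in> set es \<Longrightarrow> \<bar>a\<bar> \<le> b"
        using finite_set[of es] bdd_above_finite[of "abs ` set es"] by (auto simp: bdd_above_def)
      have "expectation (cross (?e h) (?l h)) =
        (expectation (mon \<epsilon> es) * expectation (mon \<epsilon> es)) * expectation (mon L (?l h))" if "nat (2 * b + 1) \<le> h" for h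
      proof -
        have "set es \<inter> set (shift (int h) es) = {}"
        proof -
          have "a \<noteq> int h + a'" if "a \<in> set es" "a' \<in> set es" for a a'
            using b[OF that(1)] b[OF that(2)] \<open>nat (2 * b + 1) \<le> h\<close> by linarith
          then show ?thesis by auto
        qed
        then have "expectation (mon \<epsilon> (?e h)) = expectation (mon \<epsilon> es) * expectation (mon \<epsilon> es)"
          using es8 es4[of "int h"] by (subst expectation_mon_noise_append)
            (simp_all add: expectation_mon_noise_shift le_trans[of _ 4 8] del: set_map)
        then show ?thesis
          using ls by (subst expectation_cross[OF cnt]) (auto simp del: mon_simps)
      qed
      then show ?thesis
        by (intro eventually_sequentiallyI)
    qed
    ultimately show ?thesis
      using es8 ls by (simp add: tendsto_cong expectation_cross power2_eq_square mult_ac)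
  qed
qed

text \<open>Here \<open>c a\<close> bounds the degree in the noise at the relative time \<open>a\<close>, and \<open>d\<close> the total degree in
  the liquidity. The linear combination does not depend on \<open>t\<close>, so that moments are shift invariant.\<close>

inductive polynomial_process :: "(int \<Rightarrow> nat) \<Rightarrow> nat \<Rightarrow> (int \<Rightarrow> 'a \<Rightarrow> real) \<Rightarrow> bool" where
  poly_cross: "(\<And>a. count_list es a \<le> c a) \<Longrightarrow> length ls \<le> d \<Longrightarrow> polynomial_process c d (\<lambda>t. cross (shift t es) (shift t ls))"
| poly_add: "polynomial_process c d Y \<Longrightarrow> polynomial_process c d Z \<Longrightarrow> polynomial_process c d (\<lambda>t \<omega>. Y t \<omega> + Z t \<omega>)"
| poly_cmult: "polynomial_process c d Y \<Longrightarrow> polynomial_process c d (\<lambda>t \<omega>. k * Y t \<omega>)"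

section \<open>Calculus of polynomial processes\<close>

lemma poly_noise_power: "p \<le> c a \<Longrightarrow> polynomial_process c d (\<lambda>t \<omega>. \<epsilon> (t + a) \<omega> ^ p)"
proof -
  assume "p \<le> c a"
  then have "polynomial_process c d (\<lambda>t. cross (shift t (replicate p a)) (shift t []))"
    by (intro poly_cross) (auto simp: count_list_replicate)
  then show ?thesis by (simp add: cross_def[abs_def])
qed

lemma poly_liquidity: "1 \<le> d \<Longrightarrow> polynomial_process c d (\<lambda>t. L (t + a))"
  using poly_cross[of "[]" c "[a]" d] by (simp add: cross_def[abs_def] mon_abs_simps)

lemma poly_const: "polynomial_process c d (\<lambda>t \<omega>. k)"
  using poly_cmult[OF poly_cross[of "[]" c "[]" d], of k] by (simp add: cross_def[abs_def])

lemma poly_mono: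
  assumes "polynomial_process c d Y" "\<And>a. c a \<le> c' a" "d \<le> d'"
  shows "polynomial_process c' d' Y"
  using assms
proof (induction rule: polynomial_process.induct)
  case (poly_cross es c ls d)
  have "count_list es a \<le> c' a" for a
    using poly_cross(1)[of a] poly_cross(3)[of a] by linarith
  then show ?case using poly_cross by (intro polynomial_process.poly_cross) auto
qed (auto intro: polynomial_process.intros)

lemma poly_sum:
  assumes "\<And>i. i \<in> I \<Longrightarrow> polynomial_process c d (Y i)"
  shows "polynomial_process c d (\<lambda>t \<omega>. \<Sum>i\<in>I. Y i t \<omega>)"
  using assms by (induction I rule: infinite_finite_induct) (auto intro: poly_add poly_const)

lemma poly_mult:
  assumes "polynomial_process c d Y" "polynomial_process c' d' Z"
  shows "polynomial_process (\<lambda>a. c a + c' a) (d + d') (\<lambda>t \<omega>. Y t \<omega> * Z t \<omega>)"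
  using assms
proof (induction rule: polynomial_process.induct)
  case (poly_cross es c ls d)
  from poly_cross(3,1,2) show ?case
  proof (induction rule: polynomial_process.induct)
    case (poly_cross fs c' ks d')
    have "polynomial_process (\<lambda>a. c a + c' a) (d + d') (\<lambda>t. cross (shift t (es @ fs)) (shift t (ls @ ks)))"
      using poly_cross by (intro polynomial_process.poly_cross) (auto intro: add_mono)
    then show ?case by (simp only: cross_mult map_append)
  qed (auto simp: distrib_left mult.left_commute intro: polynomial_process.intros)
qed (auto simp: distrib_right mult.assoc intro: polynomial_process.intros)

lemma poly_shift:
  assumes "polynomial_process c d Y"
  shows "polynomial_process (\<lambda>a. c (a - k)) d (\<lambda>t. Y (t + k))"
  using assms
proof (induction rule: polynomial_process.induct)
  case (poly_cross es c ls d)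
  then have "polynomial_process (\<lambda>a. c (a - k)) d (\<lambda>t. cross (shift t (shift k es)) (shift t (shift k ls)))"
    by (intro polynomial_process.poly_cross) (auto simp: count_list_shift)
  then show ?case by (simp only: shift_shift)
qed (auto intro: polynomial_process.intros)

lemma poly_measurable:
  assumes "polynomial_process c d Y"
  shows "Y t \<in> borel_measurable M"
  using assms by (induction rule: polynomial_process.induct) auto

lemma poly_integrable:
  assumes "polynomial_process c d Y" "\<And>a. c a \<le> 8" "d \<le> 4"
  shows "integrable M (Y t)"
  using assms
proof (induction rule: polynomial_process.induct)
  case (poly_cross es c ls d)
  have "count_list es a \<le> 8" for a
    using poly_cross(1)[of a] poly_cross(3)[of a] by linarith
  then show ?case
    using poly_cross by (intro integrable_cross) (auto simp: count_list_shift)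
qed auto

lemma poly_sq_integrable:
  assumes "polynomial_process c d Y" "\<And>a. c a \<le> 4" "d \<le> 2"
  shows "sq_integrable M (Y t)"
proof -
  have "c a + c a \<le> 8" for a using assms(2)[of a] by simp
  then have "integrable M (\<lambda>\<omega>. Y t \<omega> * Y t \<omega>)"
    using assms(3) by (intro poly_integrable[OF poly_mult[OF assms(1,1)]]) auto
  then show ?thesis
    using poly_measurable[OF assms(1)] by (simp add: sq_integrable_def power2_eq_square)
qed

lemma poly_ergodic:
  assumes "polynomial_process c d Y" "\<And>a. c a \<le> 4" "d \<le> 2"
  shows "ergodic M Y"
  using assms
proof (induction rule: polynomial_process.induct)
  case (poly_cross es c ls d)
  have "count_list es a \<le> 4" for a
    using poly_cross(1)[of a] poly_cross(3)[of a] by linarith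
  then show ?case
    using poly_cross by (intro ergodic_cross) auto
qed (auto intro: ergodic_add ergodic_cmult)

lemma poly_expectation_shift:
  assumes "polynomial_process c d Y" "\<And>a. c a \<le> 8" "d \<le> 4"
  shows "expectation (Y t) = expectation (Y 0)"
  using assms
proof (induction rule: polynomial_process.induct)
  case (poly_cross es c ls d)
  have "count_list es a \<le> 8" for a
    using poly_cross(1)[of a] poly_cross(3)[of a] by linarith
  then show ?case
    using poly_cross by (simp add: expectation_cross_shift)
qed (simp_all add: poly_integrable)

text \<open>The condition \<open>c 0 = 0\<close> says that \<epsilon> at the current time t does not
  occur in \<open>Y t\<close>; the factor \<open>\<epsilon> t ^ p\<close> is then independent of it.
  For the same reason no count in the joint list exceeds 8.\<close>

lemma poly_expectation_noise_mult:
  assumes "polynomial_process c d Y" "\<And>a. c a \<le> 8" "d \<le> 4" "c 0 = 0" "p \<le> 8"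
  shows "expectation (\<lambda>\<omega>. \<epsilon> t \<omega> ^ p * Y t \<omega>) = noise_moment p * expectation (Y t)"
  using assms
proof (induction rule: polynomial_process.induct)
  case (poly_cross es c ls d)
  let ?es = "shift t es" and ?r = "replicate p t" and ?ls = "shift t ls"
  have es: "count_list ?es a \<le> 8" for a
    using poly_cross(1)[of "a - t"] poly_cross(3)[of "a - t"] by (simp add: count_list_shift)
  have t: "count_list ?es t = 0"
    using poly_cross(1)[of 0] poly_cross(5) by (simp add: count_list_shift)
  have r: "count_list ?r a \<le> 8" for a
    using poly_cross(6) by (simp add: count_list_replicate)
  have "count_list (?r @ ?es) a \<le> 8" for a
    using es[of a] r[of a] t by (cases "a = t") (auto simp: count_list_replicate)
  moreover have "set ?r \<inter> set ?es = {}"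
    using t by (auto simp: count_list_0_iff simp del: set_map)
  ultimately have "expectation (cross (?r @ ?es) ?ls) =
      expectation (mon \<epsilon> ?r) * (expectation (mon \<epsilon> ?es) * expectation (mon L ?ls))"
    using es r poly_cross(2,4) by (simp add: expectation_cross expectation_mon_noise_append del: mon_simps)
  also have "expectation (mon \<epsilon> ?r) = noise_moment p"
    using poly_cross(6) by (simp add: noise_power(2) mon_replicate[abs_def])
  also have "expectation (mon \<epsilon> ?es) * expectation (mon L ?ls) = expectation (cross ?es ?ls)"
    using es poly_cross(2,4) by (simp add: expectation_cross)
  finally show ?case
    by (simp add: cross_def[abs_def] mult.assoc)
next
  case (poly_add c d Y Z)
  \<comment> \<open>Splitting the expectation of a sum requires each product to be integrable. The
    new factor raises the noise degree at relative time 0 from 0 to p, which remains within the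
    bound 8.\<close>
  have "integrable M (\<lambda>\<omega>. \<epsilon> t \<omega> ^ p * W t \<omega>)" if W: "polynomial_process c d W" for W
  proof -
    have "polynomial_process (\<lambda>a. if a = 0 then p else c a) (0 + d) (\<lambda>t \<omega>. \<epsilon> (t + 0) \<omega> ^ p * W t \<omega>)"
      using poly_add.prems(3)
      by (intro poly_mono[OF poly_mult[OF poly_noise_power[of p "\<lambda>a. if a = 0 then p else 0" 0 0] W]]) auto
    then have "integrable M (\<lambda>\<omega>. \<epsilon> (t + 0) \<omega> ^ p * W t \<omega>)"
      using poly_add.prems by (elim poly_integrable) auto
    then show ?thesis by simp
  qed
  then show ?case
    using poly_add by (simp add: distrib_left poly_integrable)
qed (simp_all add: mult.left_commute)

end

section \<open>Approximation of the squared observations\<close>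

context generalized_arch_mixing
begin

section \<open>Geometric decay of the volatility series\<close>

lemma noise_moment_2: "noise_moment 2 = 1"
  using noise_second by (simp add: noise_moment_def)

lemma sq_integrable_noise_power: "p \<le> 4 \<Longrightarrow> sq_integrable M (\<lambda>\<omega>. \<epsilon> t \<omega> ^ p)"
  using noise_power(1)[of "p * 2" t] by (simp add: sq_integrable_def power_mult[symmetric])

lemma noise_moment_le_sqrt:
  assumes "p \<le> 4" "even p"
  shows "noise_moment p \<le> sqrt (noise_moment (p * 2))"
proof -
  have "\<bar>\<epsilon> 0 \<omega> ^ p\<bar> = \<epsilon> 0 \<omega> ^ p" for \<omega>
    using assms(2) by (simp add: zero_le_even_power)
  then show ?thesis
    using l1_le_l2norm[OF sq_integrable_noise_power[OF assms(1), of 0]]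
    by (simp add: l2norm_def noise_moment_def power_mult[symmetric])
qed

lemma noise_moment_4_ge_1: "1 \<le> noise_moment 4"
  using noise_moment_le_sqrt[of 2] by (simp add: noise_moment_2)

text \<open>The L^2 norm of the factor \<open>\<alpha>\<^sub>1 * (\<epsilon> t)^2\<close> that each
  further term of the series acquires.\<close>

definition rate :: real where
  "rate = \<alpha>\<^sub>1 * sqrt (noise_moment 4)"

text \<open>Comparing the L^1 and L^2 norms of \<epsilon>^4 bounds
  \<open>sqrt (noise_moment 4)\<close> by the fourth root of the eighth moment, which the hypothesis
  on \<open>\<alpha>\<^sub>1\<close> controls.\<close>

lemma rate_bounds: "0 \<le> rate" "rate < 1"
proof -
  show "0 \<le> rate"
    using param_ranges noise_moment_4_ge_1 by (simp add: rate_def)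
  have nm: "noise_moment 4 \<le> sqrt (noise_moment 8)"
    using noise_moment_le_sqrt[of 4] by simp
  with noise_moment_4_ge_1 have "1 \<le> sqrt (noise_moment 8)" by linarith
  then have pos: "1 \<le> noise_moment 8" by simp
  have "sqrt (noise_moment 4) \<le> sqrt (sqrt (noise_moment 8))"
    using nm by simp
  also have "\<dots> = root 4 (noise_moment 8)"
    using real_root_mult_exp[of 2 2 "noise_moment 8"] by (simp add: sqrt_def)
  finally have "rate \<le> \<alpha>\<^sub>1 * root 4 (noise_moment 8)"
    using param_ranges by (simp add: rate_def mult_left_mono)
  also have "\<dots> < 1"
    using alpha1_less pos by (simp add: noise_moment_def[of 8, symmetric] pos_less_divide_eq)
  finally show "rate < 1" .
qed

text \<open>The i-th summand of the series for \<sigma>^2 at time t itself, hence in terms of data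
  up to t - 1.\<close>

definition vol_term :: "nat \<Rightarrow> int \<Rightarrow> 'a \<Rightarrow> real" where
  "vol_term i t \<omega> = (\<Prod>j<i. \<alpha>\<^sub>1 * (\<epsilon> (t - 1 - int j) \<omega>)\<^sup>2) * (\<alpha>\<^sub>0 + l\<^sub>1 * L (t - 1 - int i) \<omega>)"

lemma vol_term_0: "vol_term 0 t \<omega> = \<alpha>\<^sub>0 + l\<^sub>1 * L (t - 1) \<omega>"
  by (simp add: vol_term_def)

text \<open>The most recent factor j = 0 is split off, not the last one: what remains is a term at
  time t - 1, which does not involve \<epsilon> at t - 1.\<close>

lemma vol_term_Suc: "vol_term (Suc i) t \<omega> = \<alpha>\<^sub>1 * (\<epsilon> (t - 1) \<omega> ^ 2 * vol_term i (t - 1) \<omega>)"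
  unfolding vol_term_def prod.lessThan_Suc_shift by (simp add: algebra_simps comp_def)

text \<open>Degree bound for processes that at time t involve the noise strictly before t + k, at
  most quadratically in each variable: \<open>past 0\<close> fits \<sigma>_t^2 and
  \<open>past 1\<close> fits X_t^2.\<close>

definition past :: "int \<Rightarrow> int \<Rightarrow> nat" where
  "past k a = (if a < k then 2 else 0)"

lemma past_le: "past k a \<le> 2"
  by (simp add: past_def)

lemma poly_vol_term: "polynomial_process (past 0) 1 (vol_term i)"
proof (induction i)
  case 0
  have "polynomial_process (past 0) 1 (\<lambda>t \<omega>. \<alpha>\<^sub>0 + l\<^sub>1 * L (t + (-1)) \<omega>)"
    by (intro poly_add poly_const poly_cmult poly_liquidity) simp
  then show ?case by (simp add: vol_term_0[abs_def])
next
  case (Suc i)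
  have "polynomial_process (\<lambda>a. (if a = -1 then 2 else 0) + past 0 (a - (-1))) (0 + 1)
      (\<lambda>t \<omega>. \<epsilon> (t + (-1)) \<omega> ^ 2 * vol_term i (t + (-1)) \<omega>)"
    by (intro poly_mult poly_noise_power poly_shift Suc) simp
  then have "polynomial_process (past 0) 1 (\<lambda>t \<omega>. \<epsilon> (t + (-1)) \<omega> ^ 2 * vol_term i (t + (-1)) \<omega>)"
    by (rule poly_mono) (auto simp: past_def)
  from poly_cmult[OF this, of \<alpha>\<^sub>1] show ?case
    by (simp add: vol_term_Suc[abs_def])
qed

lemma sq_integrable_vol_term: "sq_integrable M (vol_term i t)"
  by (intro poly_sq_integrable[OF poly_vol_term]) (simp_all add: past_def)

lemma expectation_noise_mult_vol_term_sq:
  "(\<integral>\<omega>. (\<epsilon> t \<omega> ^ 2 * vol_term i t \<omega>)\<^sup>2 \<partial>M) = noise_moment 4 * (\<integral>\<omega>. (vol_term i t \<omega>)\<^sup>2 \<partial>M)"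
proof -
  have "expectation (\<lambda>\<omega>. \<epsilon> t \<omega> ^ 4 * (vol_term i t \<omega> * vol_term i t \<omega>))
      = noise_moment 4 * expectation (\<lambda>\<omega>. vol_term i t \<omega> * vol_term i t \<omega>)"
    by (rule poly_expectation_noise_mult[OF poly_mult[OF poly_vol_term poly_vol_term]])
      (auto simp: past_def)
  then show ?thesis
    by (simp add: power_mult_distrib power2_eq_square[of "vol_term _ _ _"])
qed

text \<open>In the recursion the new factor is independent of the rest, so the norm is multiplied by
  exactly \<open>rate\<close>; shift invariance of the moments makes the initial norm the same for
  all t.\<close>

lemma l2norm_vol_term: "l2norm M (vol_term i t) = l2norm M (vol_term 0 0) * rate ^ i"
proof (induction i arbitrary: t)
  case 0
  have "expectation (\<lambda>\<omega>. vol_term 0 t \<omega> * vol_term 0 t \<omega>) = expectation (\<lambda>\<omega>. vol_term 0 0 \<omega> * vol_term 0 0 \<omega>)"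
    by (rule poly_expectation_shift[OF poly_mult[OF poly_vol_term poly_vol_term]])
      (auto simp: past_def)
  then show ?case by (simp add: l2norm_def power2_eq_square)
next
  case (Suc i)
  have "l2norm M (vol_term (Suc i) t) = \<alpha>\<^sub>1 * l2norm M (\<lambda>\<omega>. \<epsilon> (t - 1) \<omega> ^ 2 * vol_term i (t - 1) \<omega>)"
    using param_ranges by (simp add: vol_term_Suc[abs_def] l2norm_cmult)
  also have "\<dots> = rate * l2norm M (vol_term i (t - 1))"
    unfolding l2norm_def expectation_noise_mult_vol_term_sq by (simp add: rate_def real_sqrt_mult)
  finally show ?case using Suc by simp
qed

lemma noise_vol_term:
  shows sq_integrable_noise_vol_term: "sq_integrable M (\<lambda>\<omega>. \<epsilon> t \<omega> ^ 2 * vol_term i t \<omega>)"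
    and l2norm_noise_vol_term: "l2norm M (\<lambda>\<omega>. \<epsilon> t \<omega> ^ 2 * vol_term i t \<omega>)
      = (sqrt (noise_moment 4) * l2norm M (vol_term 0 0)) * rate ^ i"
    and poly_noise_vol_term: "polynomial_process (past 1) 1 (\<lambda>t \<omega>. \<epsilon> t \<omega> ^ 2 * vol_term i t \<omega>)"
proof -
  have "polynomial_process (\<lambda>a. (if a = 0 then 2 else 0) + past 0 a) (0 + 1) (\<lambda>t \<omega>. \<epsilon> (t + 0) \<omega> ^ 2 * vol_term i t \<omega>)"
    by (intro poly_mult poly_noise_power poly_vol_term) simp
  then have "polynomial_process (past 1) 1 (\<lambda>t \<omega>. \<epsilon> (t + 0) \<omega> ^ 2 * vol_term i t \<omega>)"
    by (rule poly_mono) (auto simp: past_def)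
  then show "polynomial_process (past 1) 1 (\<lambda>t \<omega>. \<epsilon> t \<omega> ^ 2 * vol_term i t \<omega>)" by simp
  from this show "sq_integrable M (\<lambda>\<omega>. \<epsilon> t \<omega> ^ 2 * vol_term i t \<omega>)"
    by (rule poly_sq_integrable) (auto simp: past_def)
  show "l2norm M (\<lambda>\<omega>. \<epsilon> t \<omega> ^ 2 * vol_term i t \<omega>)
      = (sqrt (noise_moment 4) * l2norm M (vol_term 0 0)) * rate ^ i"
    using l2norm_vol_term[of i t] unfolding l2norm_def expectation_noise_mult_vol_term_sq
    by (simp add: real_sqrt_mult)
qed

lemma volatility_eq_series: "AE \<omega> in M. (\<sigma> t \<omega>)\<^sup>2 = (\<Sum>i. vol_term i t \<omega>)"
  using volatility_series[of "t - 1"] by (simp add: vol_term_def)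

lemma observable_eq_series: "AE \<omega> in M. (X t \<omega>)\<^sup>2 = (\<Sum>i. \<epsilon> t \<omega> ^ 2 * vol_term i t \<omega>)"
proof -
  have "AE \<omega> in M. summable (\<lambda>i. vol_term i t \<omega>)"
    by (rule L2_series_AE_summable[OF sq_integrable_vol_term eq_refl[OF l2norm_vol_term] rate_bounds])
  with volatility_eq_series[of t] observable_eq[of t] show ?thesis
  proof eventually_elim
    case (elim \<omega>)
    then show ?case by (simp add: power_mult_distrib suminf_mult mult.commute)
  qed
qed

text \<open>One null sequence bounds the errors at all times, which lets the approximation pass to
  time averages. The liquidity degree is fixed at 1, so that products of two approximants have
  degree 2.\<close>

definition approximates :: "(int \<Rightarrow> nat) \<Rightarrow> (nat \<Rightarrow> int \<Rightarrow> 'a \<Rightarrow> real) \<Rightarrow> (int \<Rightarrow> 'a \<Rightarrow> real) \<Rightarrow> bool" where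
  "approximates c Y U \<longleftrightarrow> (\<forall>m. polynomial_process c 1 (Y m)) \<and> (\<forall>t. sq_integrable M (U t)) \<and>
     (\<exists>\<delta>. \<delta> \<longlonglongrightarrow> 0 \<and> (\<forall>m t. l2norm M (\<lambda>\<omega>. U t \<omega> - Y m t \<omega>) \<le> \<delta> m))"

lemma approximates_volatility:
  "approximates (past 0) (\<lambda>m t \<omega>. \<Sum>i<m. vol_term i t \<omega>) (\<lambda>t \<omega>. (\<sigma> t \<omega>)\<^sup>2)"
  unfolding approximates_def
proof (intro conjI allI exI)
  note L2 = sq_integrable_vol_term eq_refl[OF l2norm_vol_term] rate_bounds _ volatility_eq_series
  note [measurable] = measurable_volatility
  show "polynomial_process (past 0) 1 (\<lambda>t \<omega>. \<Sum>i<m. vol_term i t \<omega>)" for m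
    by (intro poly_sum poly_vol_term)
  show "sq_integrable M (\<lambda>\<omega>. (\<sigma> t \<omega>)\<^sup>2)" for t
    by (rule L2_series_sq_integrable[OF L2]) measurable
  show "l2norm M (\<lambda>\<omega>. (\<sigma> t \<omega>)\<^sup>2 - (\<Sum>i<m. vol_term i t \<omega>)) \<le> l2norm M (vol_term 0 0) / (1 - rate) * rate ^ m" for m t
    by (rule L2_series_l2norm[OF L2]) measurable
  show "(\<lambda>m. l2norm M (vol_term 0 0) / (1 - rate) * rate ^ m) \<longlonglongrightarrow> 0"
    using rate_bounds by (intro tendsto_mult_right_zero LIMSEQ_power_zero) simp
qed

lemma approximates_observable:
  "approximates (past 1) (\<lambda>m t \<omega>. \<epsilon> t \<omega> ^ 2 * (\<Sum>i<m. vol_term i t \<omega>)) (\<lambda>t \<omega>. (X t \<omega>)\<^sup>2)"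
  unfolding approximates_def sum_distrib_left
proof (intro conjI allI exI)
  note L2 = sq_integrable_noise_vol_term eq_refl[OF l2norm_noise_vol_term] rate_bounds _ observable_eq_series
  note [measurable] = measurable_observable
  show "polynomial_process (past 1) 1 (\<lambda>t \<omega>. \<Sum>i<m. \<epsilon> t \<omega> ^ 2 * vol_term i t \<omega>)" for m
    by (intro poly_sum poly_noise_vol_term)
  show "sq_integrable M (\<lambda>\<omega>. (X t \<omega>)\<^sup>2)" for t
    by (rule L2_series_sq_integrable[OF L2]) measurable
  show "l2norm M (\<lambda>\<omega>. (X t \<omega>)\<^sup>2 - (\<Sum>i<m. \<epsilon> t \<omega> ^ 2 * vol_term i t \<omega>))
      \<le> (sqrt (noise_moment 4) * l2norm M (vol_term 0 0)) / (1 - rate) * rate ^ m" for m t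
    by (rule L2_series_l2norm[OF L2]) measurable
  show "(\<lambda>m. (sqrt (noise_moment 4) * l2norm M (vol_term 0 0)) / (1 - rate) * rate ^ m) \<longlonglongrightarrow> 0"
    using rate_bounds by (intro tendsto_mult_right_zero LIMSEQ_power_zero) simp
qed

lemma approximates_poly:
  assumes "polynomial_process c 1 Y" "\<And>a. c a \<le> 4"
  shows "approximates c (\<lambda>m. Y) Y"
  using assms poly_sq_integrable[OF assms(1)]
  by (auto simp: approximates_def l2norm_def intro!: exI[of _ "\<lambda>_. 0"])

lemma approximates_shift:
  assumes "approximates c Y U"
  shows "approximates (\<lambda>a. c (a - k)) (\<lambda>m t. Y m (t + k)) (\<lambda>t. U (t + k))"
  using assms unfolding approximates_def by (blast intro: poly_shift)

text \<open>A single approximant suffices: its norm does not depend on t, and its distance to U is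
  at most \<open>\<delta> 0\<close> uniformly.\<close>

lemma approximates_bounded:
  assumes "approximates c Y U" "\<And>a. c a \<le> 4"
  obtains B where "\<And>t. l2norm M (U t) \<le> B"
proof -
  obtain \<delta> where polys: "\<And>m. polynomial_process c 1 (Y m)" and U: "\<And>t. sq_integrable M (U t)"
    and d: "\<And>m t. l2norm M (\<lambda>\<omega>. U t \<omega> - Y m t \<omega>) \<le> \<delta> m"
    using assms unfolding approximates_def by blast
  note p0 = polys[of 0]
  have Y: "sq_integrable M (Y 0 t)" for t
    by (rule poly_sq_integrable[OF p0]) (use assms in auto)
  have "c a + c a \<le> 8" for a
    using assms(2)[of a] by simp
  then have "expectation (\<lambda>\<omega>. Y 0 t \<omega> * Y 0 t \<omega>) = expectation (\<lambda>\<omega>. Y 0 0 \<omega> * Y 0 0 \<omega>)" for t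
    by (rule poly_expectation_shift[OF poly_mult[OF p0 p0]]) simp
  then have norm: "l2norm M (Y 0 t) = l2norm M (Y 0 0)" for t
    by (simp add: l2norm_def power2_eq_square)
  have "l2norm M (U t) \<le> \<delta> 0 + l2norm M (Y 0 0)" for t
    using l2norm_triangle[OF sq_integrable_diff[OF U Y] Y, of t t t] d[of t 0] norm[of t] by simp
  then show ?thesis by (rule that)
qed

text \<open>Write \<open>U V - Y Z = (U - Y) V + Y (V - Z)\<close> and apply Cauchy-Schwarz to each
  summand. Noise degrees at most 2 in both factors keep \<open>Y Z\<close> within the degrees for
  which the law of large numbers holds.\<close>

lemma approximates_mult:
  assumes U: "approximates c Y U" and V: "approximates c' Z V"
    and c: "\<And>a. c a \<le> 2" "\<And>a. c' a \<le> 2"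
  shows approximates_mult_ergodic: "ergodic M (\<lambda>t \<omega>. U t \<omega> * V t \<omega>)"
    and approximates_mult_tendsto:
      "(\<lambda>m. expectation (\<lambda>\<omega>. Y m t \<omega> * Z m t \<omega>)) \<longlonglongrightarrow> expectation (\<lambda>\<omega>. U t \<omega> * V t \<omega>)"
proof -
  obtain \<delta> where pY: "\<And>m. polynomial_process c 1 (Y m)" and sU: "\<And>t. sq_integrable M (U t)" and \<delta>: "\<delta> \<longlonglongrightarrow> 0"
    and dU: "\<And>m t. l2norm M (\<lambda>\<omega>. U t \<omega> - Y m t \<omega>) \<le> \<delta> m"
    using U unfolding approximates_def by blast
  obtain \<delta>' where pZ: "\<And>m. polynomial_process c' 1 (Z m)" and sV: "\<And>t. sq_integrable M (V t)" and \<delta>': "\<delta>' \<longlonglongrightarrow> 0"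
    and dV: "\<And>m t. l2norm M (\<lambda>\<omega>. V t \<omega> - Z m t \<omega>) \<le> \<delta>' m"
    using V unfolding approximates_def by blast
  have c4: "c a \<le> 4" "c' a \<le> 4" for a
    using c[of a] by linarith+
  obtain B B' where B: "\<And>t. l2norm M (U t) \<le> B" and B': "\<And>t. l2norm M (V t) \<le> B'"
    using approximates_bounded[OF U c4(1)] approximates_bounded[OF V c4(2)] by metis
  have sY: "sq_integrable M (Y m t)" and sZ: "sq_integrable M (Z m t)" for m t
    using poly_sq_integrable[OF pY] poly_sq_integrable[OF pZ] c4 by simp_all
  note [simp] = sq_integrable_mult sU sV sY sZ
  \<comment> \<open>The factor \<open>B + \<delta> m\<close> bounds the norm of \<open>Y m t\<close>
    through its distance to \<open>U t\<close>.\<close>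
  define \<kappa> where "\<kappa> m = \<delta> m * B' + (B + \<delta> m) * \<delta>' m" for m
  have \<kappa>: "\<kappa> \<longlonglongrightarrow> 0"
    unfolding \<kappa>_def using \<delta> \<delta>' by (auto intro!: tendsto_eq_intros)
  have close: "expectation (\<lambda>\<omega>. \<bar>U t \<omega> * V t \<omega> - Y m t \<omega> * Z m t \<omega>\<bar>) \<le> \<kappa> m" for m t
  proof -
    have dU': "sq_integrable M (\<lambda>\<omega>. U t \<omega> - Y m t \<omega>)" and dV': "sq_integrable M (\<lambda>\<omega>. V t \<omega> - Z m t \<omega>)"
      by (intro sq_integrable_diff sU sV sY sZ)+
    have "expectation (\<lambda>\<omega>. \<bar>U t \<omega> * V t \<omega> - Y m t \<omega> * Z m t \<omega>\<bar>) \<le>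
        expectation (\<lambda>\<omega>. \<bar>(U t \<omega> - Y m t \<omega>) * V t \<omega>\<bar> + \<bar>Y m t \<omega> * (V t \<omega> - Z m t \<omega>)\<bar>)"
    proof (intro integral_mono)
      fix \<omega>
      have "U t \<omega> * V t \<omega> - Y m t \<omega> * Z m t \<omega> =
          (U t \<omega> - Y m t \<omega>) * V t \<omega> + Y m t \<omega> * (V t \<omega> - Z m t \<omega>)"
        by (simp add: algebra_simps)
      then show "\<bar>U t \<omega> * V t \<omega> - Y m t \<omega> * Z m t \<omega>\<bar> \<le>
          \<bar>(U t \<omega> - Y m t \<omega>) * V t \<omega>\<bar> + \<bar>Y m t \<omega> * (V t \<omega> - Z m t \<omega>)\<bar>"
        by (simp only: abs_triangle_ineq)
    qed (use sq_integrable_mult[OF dU' sV[of t]] sq_integrable_mult[OF sY[of m t] dV'] in simp_all)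
    also have "\<dots> = expectation (\<lambda>\<omega>. \<bar>(U t \<omega> - Y m t \<omega>) * V t \<omega>\<bar>)
        + expectation (\<lambda>\<omega>. \<bar>Y m t \<omega> * (V t \<omega> - Z m t \<omega>)\<bar>)"
      using sq_integrable_mult[OF dU' sV[of t]] sq_integrable_mult[OF sY[of m t] dV']
      by (intro Bochner_Integration.integral_add integrable_abs)
    also have "\<dots> \<le> l2norm M (\<lambda>\<omega>. U t \<omega> - Y m t \<omega>) * l2norm M (V t)
        + l2norm M (Y m t) * l2norm M (\<lambda>\<omega>. V t \<omega> - Z m t \<omega>)"
      by (intro add_mono l2norm_Cauchy_Schwarz dU' dV' sV sY)
    also have "\<dots> \<le> \<kappa> m"
    proof -
      have "l2norm M (Y m t) \<le> B + \<delta> m"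
        using l2norm_triangle[OF sU[of t] sq_integrable_diff[OF sY[of m t] sU[of t]]] B[of t] dU[of t m]
        by (simp add: l2norm_minus_commute[of M "Y m t"])
      then show ?thesis
        unfolding \<kappa>_def using order.trans[OF l2norm_nonneg dU]
        by (intro add_mono mult_mono dU dV B') (auto simp: l2norm_nonneg intro: order.trans[OF l2norm_nonneg])
    qed
    finally show ?thesis .
  qed
  have ergYZ: "ergodic M (\<lambda>t \<omega>. Y m t \<omega> * Z m t \<omega>)" for m
  proof -
    have "c a + c' a \<le> 4" for a
      using c[of a] by linarith
    then show ?thesis
      by (intro poly_ergodic[OF poly_mult[OF pY pZ]]) simp_all
  qed
  show "ergodic M (\<lambda>t \<omega>. U t \<omega> * V t \<omega>)"
  proof (rule ergodic_approx)
    fix e :: real assume "0 < e"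
    then obtain m where "\<bar>\<kappa> m\<bar> < e"
      using LIMSEQ_D[OF \<kappa>, of e] by auto
    then have "expectation (\<lambda>\<omega>. \<bar>U t \<omega> * V t \<omega> - Y m t \<omega> * Z m t \<omega>\<bar>) \<le> e" for t
      using close[of t m] by linarith
    then show "\<exists>W. ergodic M W \<and> (\<forall>t. expectation (\<lambda>x. \<bar>U t x * V t x - W t x\<bar>) \<le> e)"
      using ergYZ[of m] by blast
  qed simp
  show "(\<lambda>m. expectation (\<lambda>\<omega>. Y m t \<omega> * Z m t \<omega>)) \<longlonglongrightarrow> expectation (\<lambda>\<omega>. U t \<omega> * V t \<omega>)"
  proof (rule Lim_transform_bound[where g = "\<lambda>m. \<kappa> m", OF _ _, THEN LIM_zero_cancel] )
    show "\<forall>\<^sub>F m in sequentially. norm (expectation (\<lambda>\<omega>. Y m t \<omega> * Z m t \<omega>) - expectation (\<lambda>\<omega>. U t \<omega> * V t \<omega>))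
        \<le> norm (\<kappa> m)"
    proof (intro always_eventually allI)
      fix m
      have "\<bar>expectation (\<lambda>\<omega>. U t \<omega> * V t \<omega> - Y m t \<omega> * Z m t \<omega>)\<bar> \<le> \<kappa> m"
        using close[of t m] integral_abs_bound[of M "\<lambda>\<omega>. U t \<omega> * V t \<omega> - Y m t \<omega> * Z m t \<omega>"] by linarith
      then show "norm (expectation (\<lambda>\<omega>. Y m t \<omega> * Z m t \<omega>) - expectation (\<lambda>\<omega>. U t \<omega> * V t \<omega>)) \<le> norm (\<kappa> m)"
        by simp
    qed
  qed (rule \<kappa>)
qed

text \<open>For the approximants the identity is exact, because \<epsilon>_t^2 has mean 1 and, by
  \<open>c 0 = 0\<close>, is independent of what it multiplies. Both sides are therefore limits of
  one sequence.\<close>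

lemma past_innovation:
  assumes U: "approximates c Y U" and c: "\<And>a. c a \<le> 2" "c 0 = 0"
  shows "expectation (\<lambda>\<omega>. (X t \<omega>)\<^sup>2 * U t \<omega>) = expectation (\<lambda>\<omega>. (\<sigma> t \<omega>)\<^sup>2 * U t \<omega>)"
proof (rule LIMSEQ_unique)
  let ?S = "\<lambda>m t \<omega>. \<Sum>i<m. vol_term i t \<omega>"
  show "(\<lambda>m. expectation (\<lambda>\<omega>. \<epsilon> t \<omega> ^ 2 * ?S m t \<omega> * Y m t \<omega>)) \<longlonglongrightarrow> expectation (\<lambda>\<omega>. (X t \<omega>)\<^sup>2 * U t \<omega>)"
    by (rule approximates_mult_tendsto[OF approximates_observable U past_le c(1)])
  have "expectation (\<lambda>\<omega>. \<epsilon> t \<omega> ^ 2 * (?S m t \<omega> * Y m t \<omega>)) = noise_moment 2 * expectation (\<lambda>\<omega>. ?S m t \<omega> * Y m t \<omega>)" for m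
  proof (rule poly_expectation_noise_mult)
    show "polynomial_process (\<lambda>a. past 0 a + c a) (1 + 1) (\<lambda>t \<omega>. ?S m t \<omega> * Y m t \<omega>)"
      using U by (intro poly_mult poly_sum poly_vol_term) (simp add: approximates_def)
    show "past 0 a + c a \<le> 8" for a
      using c(1)[of a] past_le[of 0 a] by linarith
  qed (simp_all add: c(2) past_def)
  then have "(\<lambda>m. expectation (\<lambda>\<omega>. \<epsilon> t \<omega> ^ 2 * ?S m t \<omega> * Y m t \<omega>)) = (\<lambda>m. expectation (\<lambda>\<omega>. ?S m t \<omega> * Y m t \<omega>))"
    by (simp add: noise_moment_2 mult.assoc)
  then show "(\<lambda>m. expectation (\<lambda>\<omega>. \<epsilon> t \<omega> ^ 2 * ?S m t \<omega> * Y m t \<omega>)) \<longlonglongrightarrow> expectation (\<lambda>\<omega>. (\<sigma> t \<omega>)\<^sup>2 * U t \<omega>)"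
    using approximates_mult_tendsto[OF approximates_volatility U past_le c(1)] by simp
qed

text \<open>The same limit argument, with \<epsilon>_t^4 as the independent factor.\<close>

lemma observable_fourth_moment:
  "expectation (\<lambda>\<omega>. (X t \<omega>)\<^sup>2 * (X t \<omega>)\<^sup>2) = noise_moment 4 * expectation (\<lambda>\<omega>. (\<sigma> t \<omega>)\<^sup>2 * (\<sigma> t \<omega>)\<^sup>2)"
proof (rule LIMSEQ_unique)
  let ?S = "\<lambda>m t \<omega>. \<Sum>i<m. vol_term i t \<omega>"
  show "(\<lambda>m. expectation (\<lambda>\<omega>. (\<epsilon> t \<omega> ^ 2 * ?S m t \<omega>) * (\<epsilon> t \<omega> ^ 2 * ?S m t \<omega>)))
      \<longlonglongrightarrow> expectation (\<lambda>\<omega>. (X t \<omega>)\<^sup>2 * (X t \<omega>)\<^sup>2)"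
    by (rule approximates_mult_tendsto[OF approximates_observable approximates_observable past_le past_le])
  have "expectation (\<lambda>\<omega>. \<epsilon> t \<omega> ^ 4 * (?S m t \<omega> * ?S m t \<omega>)) = noise_moment 4 * expectation (\<lambda>\<omega>. ?S m t \<omega> * ?S m t \<omega>)" for m
    by (rule poly_expectation_noise_mult[where c = "\<lambda>a. past 0 a + past 0 a" and d = "1 + 1"],
        intro poly_mult poly_sum poly_vol_term) (simp_all add: past_def)
  moreover have "(\<lambda>\<omega>. (\<epsilon> t \<omega> ^ 2 * ?S m t \<omega>) * (\<epsilon> t \<omega> ^ 2 * ?S m t \<omega>)) = (\<lambda>\<omega>. \<epsilon> t \<omega> ^ 4 * (?S m t \<omega> * ?S m t \<omega>))" for m
    by (simp add: power2_eq_square power4_eq_xxxx mult_ac)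
  ultimately show "(\<lambda>m. expectation (\<lambda>\<omega>. (\<epsilon> t \<omega> ^ 2 * ?S m t \<omega>) * (\<epsilon> t \<omega> ^ 2 * ?S m t \<omega>)))
      \<longlonglongrightarrow> noise_moment 4 * expectation (\<lambda>\<omega>. (\<sigma> t \<omega>)\<^sup>2 * (\<sigma> t \<omega>)\<^sup>2)"
    using tendsto_mult_left[OF approximates_mult_tendsto[OF approximates_volatility approximates_volatility past_le past_le], of "noise_moment 4" t]
    by (simp only:)
qed

end

section \<open>Moment equations\<close>

lemma vector_6 [simp]:
  "(vector [a, b, c, d, e, f] :: real ^ 6) $ 1 = a"
  "(vector [a, b, c, d, e, f] :: real ^ 6) $ 2 = b"
  "(vector [a, b, c, d, e, f] :: real ^ 6) $ 3 = c"
  "(vector [a, b, c, d, e, f] :: real ^ 6) $ 4 = d"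
  "(vector [a, b, c, d, e, f] :: real ^ 6) $ 5 = e"
  "(vector [a, b, c, d, e, f] :: real ^ 6) $ 6 = f"
  unfolding vector_def by simp_all

context generalized_arch_mixing
begin

section \<open>Second-order moments of squared observations and liquidity\<close>

lemma observable_products_ergodic: "ergodic M (\<lambda>t \<omega>. (X t \<omega>)\<^sup>2 * (X (t + k) \<omega>)\<^sup>2)"
  by (rule approximates_mult_ergodic[OF approximates_observable approximates_shift[OF approximates_observable]])
    (rule past_le)+

lemma approximates_const: "approximates (\<lambda>_. 0) (\<lambda>_ _ _. k) (\<lambda>_ _. k)"
  by (intro approximates_poly poly_const) simp

lemma observable_square_ergodic: "ergodic M (\<lambda>t \<omega>. (X t \<omega>)\<^sup>2)"
  using approximates_mult_ergodic[OF approximates_observable approximates_const[of 1] past_le] by simp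

definition sq_mean :: real where
  "sq_mean = expectation (\<lambda>\<omega>. (X 0 \<omega>)\<^sup>2)"

definition sq_corr :: "int \<Rightarrow> real" where
  "sq_corr k = expectation (\<lambda>\<omega>. (X 0 \<omega>)\<^sup>2 * (X k \<omega>)\<^sup>2)"

lemma observable_sq_integrable: "sq_integrable M (\<lambda>\<omega>. (X t \<omega>)\<^sup>2)"
  using approximates_observable by (auto simp: approximates_def)

lemma volatility_sq_integrable: "sq_integrable M (\<lambda>\<omega>. (\<sigma> t \<omega>)\<^sup>2)"
  using approximates_volatility by (auto simp: approximates_def)

lemma liquidity_sq_integrable: "sq_integrable M (L t)"
  using integrable_mon_liquidity[of "[t, t]"] by (simp add: sq_integrable_def power2_eq_square mon_abs_simps)

lemma expectation_observable_sq: "expectation (\<lambda>\<omega>. (X t \<omega>)\<^sup>2) = sq_mean"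
  unfolding sq_mean_def by (rule ergodicD(2)[OF observable_square_ergodic])

lemma expectation_observable_sq_mult: "expectation (\<lambda>\<omega>. (X s \<omega>)\<^sup>2 * (X t \<omega>)\<^sup>2) = sq_corr (t - s)"
  using ergodicD(2)[OF observable_products_ergodic, of s "t - s"] by (simp add: sq_corr_def)

lemma sq_corr_minus: "sq_corr (- k) = sq_corr k"
  using expectation_observable_sq_mult[of k 0] by (simp add: sq_corr_def mult.commute)

lemma sq_cov_eq: "sq_cov M X k = sq_corr k - sq_mean\<^sup>2"
  using sq_integrable_mult[OF observable_sq_integrable observable_sq_integrable, of 0 k]
    sq_integrable_integrable[OF observable_sq_integrable]
  by (simp add: sq_cov_def cov_def algebra_simps power2_eq_square prob_space
      expectation_observable_sq[unfolded power2_eq_square] sq_corr_def)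

lemma sq_cov_abs: "sq_cov M X \<bar>k\<bar> = sq_cov M X k"
  by (cases "0 \<le> k") (simp_all add: sq_cov_eq sq_corr_minus)

lemma expectation_liquidity: "expectation (L t) = 1"
  using expectation_mon_liquidity_shift[of t "[0]"] liquidity_mean(2) by (simp add: mon_abs_simps)

lemma expectation_liquidity_mult: "expectation (\<lambda>\<omega>. L s \<omega> * L t \<omega>) = liq_cov M L (t - s) + 1"
proof -
  have "liq_cov M L (t - s) = cov M (mon L [0]) (mon L [t - s])"
    by (simp add: liq_cov_def mon_abs_simps)
  also have "\<dots> = expectation (mon L [0, t - s]) - 1"
    using cov_mon_liquidity[of "[0]" "[t - s]"] by (simp add: expectation_liquidity mon_abs_simps)
  also have "expectation (mon L [0, t - s]) = expectation (mon L (shift s [0, t - s]))"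
    by (rule expectation_mon_liquidity_shift[symmetric])
  finally show ?thesis by (simp add: mon_abs_simps)
qed

text \<open>Almost everywhere this is \<open>(\<sigma> t)^2 * ((\<epsilon> t)^2 - 1)\<close>, the
  noise that drives the autoregression of the squared observations.\<close>

definition innovation :: "int \<Rightarrow> 'a \<Rightarrow> real" where
  "innovation t \<omega> = (X t \<omega>)\<^sup>2 - (\<sigma> t \<omega>)\<^sup>2"

lemma innovation_sq_integrable: "sq_integrable M (innovation t)"
  unfolding innovation_def by (intro sq_integrable_diff observable_sq_integrable volatility_sq_integrable)

lemma innovation_orthogonal:
  assumes U: "approximates c Y U" and c: "\<And>a. c a \<le> 2" "c 0 = 0"
  shows "expectation (\<lambda>\<omega>. innovation t \<omega> * U t \<omega>) = 0"
proof -
  have "sq_integrable M (U t)" using U by (simp add: approximates_def)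
  then show ?thesis
    using past_innovation[OF assms, of t] sq_integrable_mult[OF observable_sq_integrable, of "U t" t]
      sq_integrable_mult[OF volatility_sq_integrable, of "U t" t]
    by (simp add: innovation_def left_diff_distrib)
qed

lemma expectation_innovation: "expectation (innovation t) = 0"
  using innovation_orthogonal[OF approximates_const[of 1], of t] by simp

text \<open>Liquidity contains no noise at all, so its degree function is 0 and orthogonality holds
  for every s, including times after t. The offset s - t presents \<open>L s\<close> as a process
  read at time t.\<close>

lemma innovation_liquidity: "expectation (\<lambda>\<omega>. innovation t \<omega> * L s \<omega>) = 0"
proof -
  have "approximates (\<lambda>_. 0) (\<lambda>_ t. L (t + (s - t0))) (\<lambda>t. L (t + (s - t0)))" for t0
    by (intro approximates_poly poly_liquidity) simp_all
  from innovation_orthogonal[OF this[of t], of t] show ?thesis by simp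
qed

text \<open>The earlier innovation is a difference of two processes built from noise up to time s.
  Seen from t, their noise degrees at relative time 0 are \<open>past 1 (t - s)\<close> and
  \<open>past 0 (t - s)\<close>, both 0 since t - s is at least 1.\<close>

lemma innovation_uncorrelated:
  assumes "s < t"
  shows "expectation (\<lambda>\<omega>. innovation t \<omega> * innovation s \<omega>) = 0"
proof -
  have X: "expectation (\<lambda>\<omega>. innovation t \<omega> * (X (t + (s - t)) \<omega>)\<^sup>2) = 0"
    by (rule innovation_orthogonal[OF approximates_shift[OF approximates_observable]])
      (use assms in \<open>auto simp: past_def\<close>)
  have V: "expectation (\<lambda>\<omega>. innovation t \<omega> * (\<sigma> (t + (s - t)) \<omega>)\<^sup>2) = 0"
    by (rule innovation_orthogonal[OF approximates_shift[OF approximates_volatility]])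
      (use assms in \<open>auto simp: past_def\<close>)
  show ?thesis
    using X V sq_integrable_mult[OF innovation_sq_integrable observable_sq_integrable, of t s]
      sq_integrable_mult[OF innovation_sq_integrable volatility_sq_integrable, of t s]
    by (simp add: innovation_def[of s] right_diff_distrib)
qed

text \<open>Pythagoras: X_t^2 is the sum of \<sigma>_t^2 and an innovation orthogonal to it, so the
  variance is \<open>E X^4 - E \<sigma>^4\<close>, and \<open>E \<sigma>^4\<close> is
  \<open>E X^4\<close> divided by the fourth noise moment.\<close>

lemma innovation_variance:
  "expectation (\<lambda>\<omega>. innovation t \<omega> * innovation t \<omega>) = (noise_moment 4 - 1) / noise_moment 4 * sq_corr 0"
proof -
  have V: "expectation (\<lambda>\<omega>. innovation t \<omega> * (\<sigma> t \<omega>)\<^sup>2) = 0"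
    by (rule innovation_orthogonal[OF approximates_volatility]) (simp_all add: past_def)
  have int: "integrable M (\<lambda>\<omega>. (\<sigma> t \<omega>)\<^sup>2 * (\<sigma> t \<omega>)\<^sup>2)" "integrable M (\<lambda>\<omega>. (X t \<omega>)\<^sup>2 * (X t \<omega>)\<^sup>2)"
    "integrable M (\<lambda>\<omega>. innovation t \<omega> * (\<sigma> t \<omega>)\<^sup>2)"
    by (intro sq_integrable_mult observable_sq_integrable volatility_sq_integrable innovation_sq_integrable)+
  have "(\<lambda>\<omega>. innovation t \<omega> * innovation t \<omega>) =
      (\<lambda>\<omega>. (X t \<omega>)\<^sup>2 * (X t \<omega>)\<^sup>2 - (\<sigma> t \<omega>)\<^sup>2 * (\<sigma> t \<omega>)\<^sup>2 - 2 * (innovation t \<omega> * (\<sigma> t \<omega>)\<^sup>2))"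
    by (simp add: innovation_def algebra_simps)
  then have "expectation (\<lambda>\<omega>. innovation t \<omega> * innovation t \<omega>) =
      expectation (\<lambda>\<omega>. (X t \<omega>)\<^sup>2 * (X t \<omega>)\<^sup>2) - expectation (\<lambda>\<omega>. (\<sigma> t \<omega>)\<^sup>2 * (\<sigma> t \<omega>)\<^sup>2)
        - 2 * expectation (\<lambda>\<omega>. innovation t \<omega> * (\<sigma> t \<omega>)\<^sup>2)"
    using int by (simp only: Bochner_Integration.integral_diff Bochner_Integration.integrable_diff
        integral_mult_right_zero integrable_mult_right)
  moreover have "expectation (\<lambda>\<omega>. (\<sigma> t \<omega>)\<^sup>2 * (\<sigma> t \<omega>)\<^sup>2) = sq_corr 0 / noise_moment 4"
    using observable_fourth_moment[of t] expectation_observable_sq_mult[of t t] noise_moment_4_ge_1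
    by (simp only: diff_self) (simp add: field_simps)
  ultimately show ?thesis
    using V expectation_observable_sq_mult[of t t] noise_moment_4_ge_1
    by (simp only: diff_self) (simp add: field_simps)
qed

text \<open>Both moment equations come from the AR(1) form
  \<open>X\<^sub>t\<^sup>2 - \<alpha>\<^sub>1 X\<^sub>t\<^sub>-\<^sub>1\<^sup>2 - \<alpha>\<^sub>0 = (X\<^sub>t\<^sup>2 - \<sigma>\<^sub>t\<^sup>2) + l\<^sub>1 L\<^sub>t\<^sub>-\<^sub>1\<close>, whose innovations are orthogonal to the liquidity
  and to the past.\<close>

lemma observable_autoregression:
  "AE \<omega> in M. (X t \<omega>)\<^sup>2 - \<alpha>\<^sub>1 * (X (t - 1) \<omega>)\<^sup>2 - \<alpha>\<^sub>0 = innovation t \<omega> + l\<^sub>1 * L (t - 1) \<omega>"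
  using volatility_eq[of t] by eventually_elim (simp add: innovation_def)

lemma mean_equation: "sq_mean * (1 - \<alpha>\<^sub>1) - \<alpha>\<^sub>0 = l\<^sub>1"
proof -
  note int = sq_integrable_integrable[OF observable_sq_integrable]
    sq_integrable_integrable[OF innovation_sq_integrable] sq_integrable_integrable[OF liquidity_sq_integrable]
  have "expectation (\<lambda>\<omega>. (X 0 \<omega>)\<^sup>2 - \<alpha>\<^sub>1 * (X (0 - 1) \<omega>)\<^sup>2 - \<alpha>\<^sub>0) =
      expectation (\<lambda>\<omega>. innovation 0 \<omega> + l\<^sub>1 * L (0 - 1) \<omega>)"
    using observable_autoregression[of 0] int
    by (intro integral_cong_AE) (auto intro: borel_measurable_integrable)
  then show ?thesis
    using int by (simp add: expectation_observable_sq expectation_innovation expectation_liquidity prob_space algebra_simps)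
qed

text \<open>The autoregressive forms at times n and 0 are multiplied and integrated. The covariance
  of the innovations is left unevaluated, so that the same identity serves lag 0, where it is a
  variance, and the other lags, where it vanishes.\<close>

lemma covariance_equation:
  "(1 + \<alpha>\<^sub>1\<^sup>2) * sq_cov M X n - \<alpha>\<^sub>1 * (sq_cov M X (n - 1) + sq_cov M X (n + 1)) =
     expectation (\<lambda>\<omega>. innovation n \<omega> * innovation 0 \<omega>) + l\<^sub>1\<^sup>2 * liq_cov M L n"
proof -
  have int: "integrable M (\<lambda>\<omega>. (X s \<omega>)\<^sup>2 * (X t \<omega>)\<^sup>2)" "integrable M (\<lambda>\<omega>. innovation s \<omega> * innovation t \<omega>)"
    "integrable M (\<lambda>\<omega>. innovation s \<omega> * L t \<omega>)" "integrable M (\<lambda>\<omega>. L s \<omega> * L t \<omega>)"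
    "integrable M (\<lambda>\<omega>. (X t \<omega>)\<^sup>2)" for s t
    by (intro sq_integrable_mult sq_integrable_integrable observable_sq_integrable
        innovation_sq_integrable liquidity_sq_integrable)+
  have [measurable]: "innovation t \<in> borel_measurable M" "X t \<in> borel_measurable M" for t
    using sq_integrable_measurable[OF innovation_sq_integrable] measurable_observable by auto
  let ?Z = "\<lambda>t \<omega>. (X t \<omega>)\<^sup>2 - \<alpha>\<^sub>1 * (X (t - 1) \<omega>)\<^sup>2 - \<alpha>\<^sub>0"
  have "(\<lambda>\<omega>. ?Z n \<omega> * ?Z 0 \<omega>) = (\<lambda>\<omega>. (X 0 \<omega>)\<^sup>2 * (X n \<omega>)\<^sup>2 - \<alpha>\<^sub>1 * ((X (- 1) \<omega>)\<^sup>2 * (X n \<omega>)\<^sup>2)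
      - \<alpha>\<^sub>1 * ((X 0 \<omega>)\<^sup>2 * (X (n - 1) \<omega>)\<^sup>2) + \<alpha>\<^sub>1\<^sup>2 * ((X (- 1) \<omega>)\<^sup>2 * (X (n - 1) \<omega>)\<^sup>2)
      - \<alpha>\<^sub>0 * (X n \<omega>)\<^sup>2 - \<alpha>\<^sub>0 * (X 0 \<omega>)\<^sup>2 + \<alpha>\<^sub>0 * \<alpha>\<^sub>1 * (X (n - 1) \<omega>)\<^sup>2 + \<alpha>\<^sub>0 * \<alpha>\<^sub>1 * (X (- 1) \<omega>)\<^sup>2 + \<alpha>\<^sub>0\<^sup>2)"
    by (simp add: algebra_simps power2_eq_square)
  then have "expectation (\<lambda>\<omega>. ?Z n \<omega> * ?Z 0 \<omega>) = sq_corr n - \<alpha>\<^sub>1 * sq_corr (n + 1) - \<alpha>\<^sub>1 * sq_corr (n - 1)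
      + \<alpha>\<^sub>1\<^sup>2 * sq_corr n - \<alpha>\<^sub>0 * sq_mean - \<alpha>\<^sub>0 * sq_mean + \<alpha>\<^sub>0 * \<alpha>\<^sub>1 * sq_mean + \<alpha>\<^sub>0 * \<alpha>\<^sub>1 * sq_mean + \<alpha>\<^sub>0\<^sup>2"
    using int by (simp add: expectation_observable_sq expectation_observable_sq_mult prob_space)
  moreover have "expectation (\<lambda>\<omega>. ?Z n \<omega> * ?Z 0 \<omega>) =
      expectation (\<lambda>\<omega>. innovation n \<omega> * innovation 0 \<omega>) + l\<^sub>1\<^sup>2 * (liq_cov M L n + 1)"
  proof -
    have "expectation (\<lambda>\<omega>. ?Z n \<omega> * ?Z 0 \<omega>) =
        expectation (\<lambda>\<omega>. (innovation n \<omega> + l\<^sub>1 * L (n - 1) \<omega>) * (innovation 0 \<omega> + l\<^sub>1 * L (0 - 1) \<omega>))"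
      using observable_autoregression[of n] observable_autoregression[of 0]
      by (intro integral_cong_AE) auto
    also have "(\<lambda>\<omega>. (innovation n \<omega> + l\<^sub>1 * L (n - 1) \<omega>) * (innovation 0 \<omega> + l\<^sub>1 * L (0 - 1) \<omega>)) =
        (\<lambda>\<omega>. innovation n \<omega> * innovation 0 \<omega> + l\<^sub>1 * (innovation n \<omega> * L (- 1) \<omega>)
          + l\<^sub>1 * (innovation 0 \<omega> * L (n - 1) \<omega>) + l\<^sub>1\<^sup>2 * (L (- 1) \<omega> * L (n - 1) \<omega>))"
      by (simp add: algebra_simps power2_eq_square)
    also have "expectation \<dots> = expectation (\<lambda>\<omega>. innovation n \<omega> * innovation 0 \<omega>) + l\<^sub>1\<^sup>2 * (liq_cov M L n + 1)"
      using int by (simp add: innovation_liquidity expectation_liquidity_mult)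
    finally show ?thesis .
  qed
  \<comment> \<open>Passing from \<open>sq_corr\<close> to \<open>sq_cov\<close> leaves the constant
    \<open>(sq_mean * (1 - \<alpha>\<^sub>1) - \<alpha>\<^sub>0)^2\<close>, which the squared mean
    equation cancels against the \<open>l\<^sub>1^2\<close> from the mean of the liquidity.\<close>
  ultimately show ?thesis
    unfolding sq_cov_eq using arg_cong[OF mean_equation, of "\<lambda>x. x\<^sup>2"]
    by (simp add: algebra_simps power2_eq_square)
qed

lemma covariance_equation_nonzero:
  assumes "n \<noteq> 0"
  shows "(1 + \<alpha>\<^sub>1\<^sup>2) * sq_cov M X n - \<alpha>\<^sub>1 * (sq_cov M X (n - 1) + sq_cov M X (n + 1)) = l\<^sub>1\<^sup>2 * liq_cov M L n"
proof -
  have "expectation (\<lambda>\<omega>. innovation n \<omega> * innovation 0 \<omega>) = 0"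
    using assms innovation_uncorrelated[of 0 n] innovation_uncorrelated[of n 0]
    by (cases "0 < n") (simp_all add: mult.commute)
  then show ?thesis by (simp add: covariance_equation)
qed

lemma variance_noise_sq: "variance (\<lambda>\<omega>. (\<epsilon> 0 \<omega>)\<^sup>2) = noise_moment 4 - 1"
  using noise_power(1)[of 4 0] noise_second
  by (subst variance_eq) (simp_all add: noise_moment_def power_mult[symmetric])

lemma variance_equation:
  "(1 + \<alpha>\<^sub>1\<^sup>2) * sq_cov M X 0 - 2 * \<alpha>\<^sub>1 * sq_cov M X 1 =
    l\<^sub>1\<^sup>2 * liq_cov M L 0 + expectation (\<lambda>\<omega>. X 0 \<omega> ^ 4) * variance (\<lambda>\<omega>. (\<epsilon> 0 \<omega>)\<^sup>2) / expectation (\<lambda>\<omega>. \<epsilon> 0 \<omega> ^ 4)"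
proof -
  have "sq_corr 0 = expectation (\<lambda>\<omega>. X 0 \<omega> ^ 4)"
    by (simp add: sq_corr_def)
  moreover have "sq_cov M X (- 1) = sq_cov M X 1"
    using sq_cov_abs[of "- 1"] by simp
  ultimately show ?thesis
    using covariance_equation[of 0] unfolding variance_noise_sq noise_moment_def[of 4, symmetric]
    by (simp add: innovation_variance mult_ac add.commute)
qed

text \<open>Here \<open>a0\<close>, \<open>b0\<close> and \<open>c0\<close> originate: the variance
  equation times s(n)/s(0) has the same term \<open>l\<^sub>1^2 * s(n)\<close> as the covariance
  equation at lag n, and eliminating it leaves a quadratic in
  \<open>\<alpha>\<^sub>1\<close>.\<close>

lemma quadratic_equation:
  assumes "n \<noteq> 0" "liq_cov M L 0 \<noteq> 0"
  shows "a0 M L n (gamma_vec M X n) * \<alpha>\<^sub>1\<^sup>2 + b0 M L n (gamma_vec M X n) * \<alpha>\<^sub>1 + c0 M \<epsilon> L n (gamma_vec M X n) = 0"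
proof -
  define r where "r = liq_cov M L n / liq_cov M L 0"
  define K where "K = expectation (\<lambda>\<omega>. X 0 \<omega> ^ 4) * variance (\<lambda>\<omega>. (\<epsilon> 0 \<omega>)\<^sup>2) / expectation (\<lambda>\<omega>. \<epsilon> 0 \<omega> ^ 4)"
  have "r * (l\<^sub>1\<^sup>2 * liq_cov M L 0) = l\<^sub>1\<^sup>2 * liq_cov M L n"
    using assms(2) by (simp add: r_def)
  then have "r * ((1 + \<alpha>\<^sub>1\<^sup>2) * sq_cov M X 0 - 2 * \<alpha>\<^sub>1 * sq_cov M X 1 - K) =
      (1 + \<alpha>\<^sub>1\<^sup>2) * sq_cov M X n - \<alpha>\<^sub>1 * (sq_cov M X (n - 1) + sq_cov M X (n + 1))"
    using covariance_equation_nonzero[OF assms(1)] variance_equation by (simp add: K_def)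
  then show ?thesis
    unfolding a0_def b0_def c0_def r_def[symmetric] gamma_vec_def vector_6 K_def[symmetric]
    by (simp add: algebra_simps)
qed

end

section \<open>Consistency of the estimators\<close>

context generalized_arch_mixing
begin

section \<open>Consistency of the empirical moments\<close>

lemma mu_hat_consistent: "converges_in_probability M (mu_hat X) sq_mean"
  using ergodic_converges_in_probability[OF observable_square_ergodic, of 0]
  by (simp add: mu_hat_def[abs_def] sq_mean_def)

lemma mu2_hat_consistent: "converges_in_probability M (mu2_hat X) (expectation (\<lambda>\<omega>. X 0 \<omega> ^ 4))"
  using ergodic_converges_in_probability[OF observable_products_ergodic[of 0], of 0]
  by (simp add: mu2_hat_def[abs_def])

lemma gamma_hat_consistent: "converges_in_probability M (\<lambda>N. gamma_hat X N k) (sq_cov M X k)"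
proof -
  define j where "j = nat \<bar>k\<bar>"
  have j: "int j = \<bar>k\<bar>" by (simp add: j_def)
  \<comment> \<open>The number of summands relative to N, the coefficient of the squared empirical
    mean below. For N below j the sum is empty, and \<open>nat\<close> returns 0
    accordingly.\<close>
  have card: "(\<lambda>N. 1 / real N * real (nat (int N - int j))) \<longlonglongrightarrow> 1"
  proof (rule Lim_transform_eventually)
    show "(\<lambda>N. 1 - real j * (1 / real N)) \<longlonglongrightarrow> 1"
      using tendsto_diff[OF tendsto_const tendsto_mult_right_zero[OF lim_1_over_n], of 1] by simp
    show "\<forall>\<^sub>F N in sequentially. 1 - real j * (1 / real N) = 1 / real N * real (nat (int N - int j))"
      using eventually_gt_at_top[of j]
      by eventually_elim (simp add: nat_diff_distrib of_nat_diff field_simps)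
  qed
  have shifted: "ergodic M (\<lambda>t \<omega>. (X (t + int j) \<omega>)\<^sup>2)"
    using approximates_mult_ergodic[OF approximates_shift[OF approximates_observable] approximates_const[of 1] past_le, of "int j"]
    by simp
  \<comment> \<open>The centring uses the mean of the full sample, so nothing cancels against the
    truncated sums; each of them is an average with its own limit.\<close>
  have expand: "gamma_hat X N k \<omega> = 1 / real N * (\<Sum>t = 1..int N - int j. (X t \<omega>)\<^sup>2 * (X (t + int j) \<omega>)\<^sup>2)
      - mu_hat X N \<omega> * (1 / real N * (\<Sum>t = 1..int N - int j. (X t \<omega>)\<^sup>2)
        + 1 / real N * (\<Sum>t = 1..int N - int j. (X (t + int j) \<omega>)\<^sup>2))
      + mu_hat X N \<omega> * mu_hat X N \<omega> * (1 / real N * real (nat (int N - int j)))" for N \<omega>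
  proof -
    have prod: "(\<Sum>t = 1..int N - int j. ((X t \<omega>)\<^sup>2 - m) * ((X (t + int j) \<omega>)\<^sup>2 - m)) =
        (\<Sum>t = 1..int N - int j. (X t \<omega>)\<^sup>2 * (X (t + int j) \<omega>)\<^sup>2)
        - m * ((\<Sum>t = 1..int N - int j. (X t \<omega>)\<^sup>2) + (\<Sum>t = 1..int N - int j. (X (t + int j) \<omega>)\<^sup>2))
        + m * m * real (nat (int N - int j))" for m
      by (simp add: left_diff_distrib right_diff_distrib sum_subtractf sum_distrib_left sum_distrib_right
          distrib_left mult.commute)
    show ?thesis
      unfolding gamma_hat_def j[symmetric] prod by (simp add: algebra_simps)
  qed
  have "converges_in_probability M (\<lambda>N. gamma_hat X N k)
      (expectation (\<lambda>\<omega>. (X 0 \<omega>)\<^sup>2 * (X (0 + int j) \<omega>)\<^sup>2)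
        - sq_mean * (expectation (\<lambda>\<omega>. (X 0 \<omega>)\<^sup>2) + expectation (\<lambda>\<omega>. (X (0 + int j) \<omega>)\<^sup>2)) + sq_mean * sq_mean * 1)"
    unfolding expand[abs_def]
    by (intro converges_in_probability_add converges_in_probability_diff converges_in_probability_mult mu_hat_consistent
        converges_in_probability_deterministic[OF card] ergodic_converges_in_probability observable_products_ergodic
        observable_square_ergodic shifted zero_le_power2 mult_nonneg_nonneg)
  moreover have "expectation (\<lambda>\<omega>. (X 0 \<omega>)\<^sup>2 * (X (0 + int j) \<omega>)\<^sup>2)
        - sq_mean * (expectation (\<lambda>\<omega>. (X 0 \<omega>)\<^sup>2) + expectation (\<lambda>\<omega>. (X (0 + int j) \<omega>)\<^sup>2)) + sq_mean * sq_mean * 1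
      = sq_cov M X \<bar>k\<bar>"
    unfolding expectation_observable_sq expectation_observable_sq_mult sq_cov_eq
    by (simp add: j power2_eq_square algebra_simps)
  ultimately show ?thesis by (simp add: sq_cov_abs)
qed

lemma coefficients_consistent:
  shows a0_consistent: "converges_in_probability M (\<lambda>N \<omega>. a0 M L n (gamma_vec_hat X n N \<omega>)) (a0 M L n (gamma_vec M X n))"
    and b0_consistent: "converges_in_probability M (\<lambda>N \<omega>. b0 M L n (gamma_vec_hat X n N \<omega>)) (b0 M L n (gamma_vec M X n))"
    and c0_consistent: "converges_in_probability M (\<lambda>N \<omega>. c0 M \<epsilon> L n (gamma_vec_hat X n N \<omega>)) (c0 M \<epsilon> L n (gamma_vec M X n))"
proof -
  note intros = converges_in_probability_add converges_in_probability_diff converges_in_probability_mult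
    converges_in_probability_const gamma_hat_consistent mu2_hat_consistent
  show "converges_in_probability M (\<lambda>N \<omega>. a0 M L n (gamma_vec_hat X n N \<omega>)) (a0 M L n (gamma_vec M X n))"
    unfolding a0_def gamma_vec_hat_def gamma_vec_def vector_6 by (intro intros)
  show "converges_in_probability M (\<lambda>N \<omega>. b0 M L n (gamma_vec_hat X n N \<omega>)) (b0 M L n (gamma_vec M X n))"
    unfolding b0_def gamma_vec_hat_def gamma_vec_def vector_6 by (intro intros)
  show "converges_in_probability M (\<lambda>N \<omega>. c0 M \<epsilon> L n (gamma_vec_hat X n N \<omega>)) (c0 M \<epsilon> L n (gamma_vec M X n))"
    unfolding c0_def gamma_vec_hat_def gamma_vec_def vector_6 divide_inverse[of "_ * _"] by (intro intros)
qed

lemma g0_consistent: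
  "converges_in_probability M (\<lambda>N \<omega>. g0 M \<epsilon> L n (gamma_vec_hat X n N \<omega>)) (g0 M \<epsilon> L n (gamma_vec M X n))"
  unfolding g0_def power2_eq_square
  by (intro converges_in_probability_diff converges_in_probability_mult converges_in_probability_const
      a0_consistent b0_consistent c0_consistent)

text \<open>Since \<open>\<alpha>\<^sub>1\<close> solves the quadratic,
  \<open>(2 * a * \<alpha>\<^sub>1 + b)^2 = g\<close>, so one of the signs fits; g > 0 makes the two
  roots distinct, so only one does.\<close>

lemma unique_correct_sign:
  assumes "n \<noteq> 0" "liq_cov M L 0 \<noteq> 0" "a0 M L n (gamma_vec M X n) \<noteq> 0" "g0 M \<epsilon> L n (gamma_vec M X n) > 0"
  shows "\<exists>!sg. correct_sign M \<epsilon> L X n \<alpha>\<^sub>1 sg"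
proof -
  define a b c g where "a = a0 M L n (gamma_vec M X n)" "b = b0 M L n (gamma_vec M X n)"
    "c = c0 M \<epsilon> L n (gamma_vec M X n)" "g = g0 M \<epsilon> L n (gamma_vec M X n)"
  note defs = this[symmetric]
  have a: "a \<noteq> 0" and g: "0 < g"
    using assms(3,4) unfolding defs by simp_all
  have gdef: "g = b\<^sup>2 - 4 * a * c"
    unfolding defs[symmetric] g0_def ..
  have quad: "a * \<alpha>\<^sub>1\<^sup>2 + b * \<alpha>\<^sub>1 + c = 0"
    using quadratic_equation[OF assms(1,2)] by (simp add: defs)
  have sign_iff: "correct_sign M \<epsilon> L X n \<alpha>\<^sub>1 sg \<longleftrightarrow> sg \<in> {1, - 1} \<and> 2 * a * \<alpha>\<^sub>1 + b = sg * sqrt g" for sg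
    unfolding correct_sign_def defs using a by (auto simp: field_simps)
  have "(2 * a * \<alpha>\<^sub>1 + b)\<^sup>2 = 4 * a * (a * \<alpha>\<^sub>1\<^sup>2 + b * \<alpha>\<^sub>1 + c) + g"
    by (simp add: gdef power2_eq_square algebra_simps)
  also have "\<dots> = (sqrt g)\<^sup>2" using quad g by simp
  finally have "2 * a * \<alpha>\<^sub>1 + b = sqrt g \<or> 2 * a * \<alpha>\<^sub>1 + b = - sqrt g"
    by (simp only: power2_eq_iff)
  then show ?thesis
    using g unfolding sign_iff by auto
qed

lemma alpha1_hat_consistent:
  assumes a: "a0 M L n (gamma_vec M X n) \<noteq> 0" and g: "g0 M \<epsilon> L n (gamma_vec M X n) > 0"
    and sg: "correct_sign M \<epsilon> L X n \<alpha>\<^sub>1 sg"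
  shows "converges_in_probability M (alpha1_hat M \<epsilon> L X n sg d) (of_real \<alpha>\<^sub>1)"
proof -
  \<comment> \<open>The negation is written as a difference from 0 so that the rule for differences
    applies to it.\<close>
  have "converges_in_probability M (\<lambda>N \<omega>. 0 - complex_of_real (b0 M L n (gamma_vec_hat X n N \<omega>))
        + of_real sg * csqrt (of_real (g0 M \<epsilon> L n (gamma_vec_hat X n N \<omega>))))
      (- complex_of_real (b0 M L n (gamma_vec M X n)) + of_real sg * of_real (sqrt (g0 M \<epsilon> L n (gamma_vec M X n))))"
    by (subst diff_0[symmetric], intro converges_in_probability_add converges_in_probability_diff converges_in_probability_mult
        converges_in_probability_const converges_in_probability_complex_of_real b0_consistent
        converges_in_probability_csqrt g0_consistent g)
  from converges_in_probability_divide[OF this a0_consistent a, of d]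
  have "converges_in_probability M (alpha1_hat M \<epsilon> L X n sg d)
    ((- complex_of_real (b0 M L n (gamma_vec M X n)) + of_real sg * of_real (sqrt (g0 M \<epsilon> L n (gamma_vec M X n))))
      / of_real (2 * a0 M L n (gamma_vec M X n)))"
    by (simp only: alpha1_hat_def[abs_def] Let_def diff_0)
  moreover have "complex_of_real \<alpha>\<^sub>1 =
      (- complex_of_real (b0 M L n (gamma_vec M X n)) + of_real sg * of_real (sqrt (g0 M \<epsilon> L n (gamma_vec M X n))))
      / of_real (2 * a0 M L n (gamma_vec M X n))"
    using sg unfolding correct_sign_def by (metis of_real_add of_real_divide of_real_minus of_real_mult)
  ultimately show ?thesis by simp
qed

text \<open>By the variance equation the radicand tends to \<open>l\<^sub>1^2\<close>, a positive
  number, and positivity of \<open>l\<^sub>1\<close> makes the principal root the right one.\<close>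

lemma l1_hat_consistent:
  assumes s: "liq_cov M L 0 \<noteq> 0"
    and \<alpha>: "converges_in_probability M (alpha1_hat M \<epsilon> L X n sg d) (of_real \<alpha>\<^sub>1)"
  shows "converges_in_probability M (l1_hat M \<epsilon> L X n sg d) (of_real l\<^sub>1)"
proof -
  let ?V = "variance (\<lambda>\<omega>. (\<epsilon> 0 \<omega>)\<^sup>2)" and ?K = "expectation (\<lambda>\<omega>. \<epsilon> 0 \<omega> ^ 4)"
  let ?lim = "1 / liq_cov M L 0 * (\<alpha>\<^sub>1 * \<alpha>\<^sub>1 * sq_cov M X 0 - 2 * \<alpha>\<^sub>1 * sq_cov M X 1 + sq_cov M X 0
      - expectation (\<lambda>\<omega>. X 0 \<omega> ^ 4) * ?V * inverse ?K)"
  have "converges_in_probability M (\<lambda>N \<omega>. 1 / of_real (liq_cov M L 0) *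
        (alpha1_hat M \<epsilon> L X n sg d N \<omega> * alpha1_hat M \<epsilon> L X n sg d N \<omega> * of_real (gamma_hat X N 0 \<omega>)
          - 2 * alpha1_hat M \<epsilon> L X n sg d N \<omega> * of_real (gamma_hat X N 1 \<omega>)
         + of_real (gamma_hat X N 0 \<omega>) - of_real (mu2_hat X N \<omega> * ?V * inverse ?K)))
      (1 / of_real (liq_cov M L 0) * (of_real \<alpha>\<^sub>1 * of_real \<alpha>\<^sub>1 * of_real (sq_cov M X 0)
        - 2 * of_real \<alpha>\<^sub>1 * of_real (sq_cov M X 1) + of_real (sq_cov M X 0)
        - of_real (expectation (\<lambda>\<omega>. X 0 \<omega> ^ 4) * ?V * inverse ?K)))"
    by (intro converges_in_probability_add converges_in_probability_diff converges_in_probability_mult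
        converges_in_probability_const converges_in_probability_complex_of_real \<alpha> gamma_hat_consistent mu2_hat_consistent)
  then have conv: "converges_in_probability M (\<lambda>N \<omega>. 1 / of_real (liq_cov M L 0) *
        ((alpha1_hat M \<epsilon> L X n sg d N \<omega>)\<^sup>2 * of_real (gamma_hat X N 0 \<omega>)
          - 2 * alpha1_hat M \<epsilon> L X n sg d N \<omega> * of_real (gamma_hat X N 1 \<omega>)
         + of_real (gamma_hat X N 0 \<omega>) - of_real (mu2_hat X N \<omega> * ?V / ?K)))
      (of_real ?lim)"
    by (simp add: power2_eq_square divide_inverse[of "_ * _"])
  have lim: "?lim = l\<^sub>1\<^sup>2"
  proof -
    have "\<alpha>\<^sub>1 * \<alpha>\<^sub>1 * sq_cov M X 0 - 2 * \<alpha>\<^sub>1 * sq_cov M X 1 + sq_cov M X 0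
      - expectation (\<lambda>\<omega>. X 0 \<omega> ^ 4) * ?V * inverse ?K = l\<^sub>1\<^sup>2 * liq_cov M L 0"
      using variance_equation by (simp only: divide_inverse power2_eq_square distrib_right)
    then show ?thesis using s by simp
  qed
  have "converges_in_probability M (\<lambda>N \<omega>. csqrt (1 / of_real (liq_cov M L 0) *
        ((alpha1_hat M \<epsilon> L X n sg d N \<omega>)\<^sup>2 * of_real (gamma_hat X N 0 \<omega>)
          - 2 * alpha1_hat M \<epsilon> L X n sg d N \<omega> * of_real (gamma_hat X N 1 \<omega>)
         + of_real (gamma_hat X N 0 \<omega>) - of_real (mu2_hat X N \<omega> * ?V / ?K))))
      (of_real (sqrt (l\<^sub>1\<^sup>2)))"
    by (rule converges_in_probability_csqrt[OF conv[unfolded lim]]) (use param_ranges in simp)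
  then show ?thesis
    using param_ranges by (simp only: l1_hat_def[abs_def] Let_def real_sqrt_abs abs_of_pos)
qed

lemma alpha0_hat_consistent:
  assumes "converges_in_probability M (alpha1_hat M \<epsilon> L X n sg d) (of_real \<alpha>\<^sub>1)"
    and "converges_in_probability M (l1_hat M \<epsilon> L X n sg d) (of_real l\<^sub>1)"
  shows "converges_in_probability M (alpha0_hat M \<epsilon> L X n sg d) (of_real \<alpha>\<^sub>0)"
proof -
  have "converges_in_probability M (alpha0_hat M \<epsilon> L X n sg d) (of_real sq_mean * (1 - of_real \<alpha>\<^sub>1) - of_real l\<^sub>1)"
    unfolding alpha0_hat_def[abs_def]
    by (intro converges_in_probability_diff converges_in_probability_mult converges_in_probability_const
        converges_in_probability_complex_of_real mu_hat_consistent assms)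
  moreover have "of_real sq_mean * (1 - of_real \<alpha>\<^sub>1) - of_real l\<^sub>1 = complex_of_real \<alpha>\<^sub>0"
    unfolding mean_equation[symmetric] by simp
  ultimately show ?thesis by simp
qed

end

theorem theorem3p8:
  fixes M :: "'a measure"
    and \<epsilon> L \<sigma> X :: "int \<Rightarrow> 'a \<Rightarrow> real"
    and \<alpha>\<^sub>0 \<alpha>\<^sub>1 l\<^sub>1 :: real
    and n :: int
    and d :: complex
  assumes model: "generalized_arch M \<epsilon> L \<sigma> X \<alpha>\<^sub>0 \<alpha>\<^sub>1 l\<^sub>1"
    and L_moment: "integrable M (\<lambda>\<omega>. L 0 \<omega> ^ 4)"
    and eps_moment: "integrable M (\<lambda>\<omega>. \<epsilon> 0 \<omega> ^ 8)"
    and alpha1_less: "\<alpha>\<^sub>1 < 1 / root 4 (prob_space.expectation M (\<lambda>\<omega>. \<epsilon> 0 \<omega> ^ 8))"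
    and mixing1: "((\<lambda>t. cov M (L 0) (L t)) \<longlongrightarrow> 0) at_top"
    and mixing2_pos: "\<And>m. ((\<lambda>t. cov M (\<lambda>\<omega>. L 0 \<omega> * L m \<omega>) (L t)) \<longlongrightarrow> 0) at_top"
    and mixing2_neg: "\<And>m. ((\<lambda>t. cov M (\<lambda>\<omega>. L 0 \<omega> * L m \<omega>) (L (- t))) \<longlongrightarrow> 0) at_top"
    and mixing3: "\<And>m\<^sub>1 m\<^sub>2. ((\<lambda>t. cov M (\<lambda>\<omega>. L 0 \<omega> * L m\<^sub>1 \<omega>) (\<lambda>\<omega>. L t \<omega> * L (t + m\<^sub>2) \<omega>)) \<longlongrightarrow> 0) at_top"
    and s0: "liq_cov M L 0 \<noteq> 0"
    and n: "n \<noteq> 0"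
    and a0: "a0 M L n (gamma_vec M X n) \<noteq> 0"
    and g0: "g0 M \<epsilon> L n (gamma_vec M X n) > 0"
  shows "(\<exists>!sg. correct_sign M \<epsilon> L X n \<alpha>\<^sub>1 sg) \<and>
    (\<forall>sg. correct_sign M \<epsilon> L X n \<alpha>\<^sub>1 sg \<longrightarrow>
       converges_in_probability M (alpha1_hat M \<epsilon> L X n sg d) (of_real \<alpha>\<^sub>1) \<and>
       converges_in_probability M (l1_hat M \<epsilon> L X n sg d) (of_real l\<^sub>1) \<and>
       converges_in_probability M (alpha0_hat M \<epsilon> L X n sg d) (of_real \<alpha>\<^sub>0))"
proof -
  interpret generalized_arch M \<epsilon> L \<sigma> X \<alpha>\<^sub>0 \<alpha>\<^sub>1 l\<^sub>1 by (rule model)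
  interpret generalized_arch_mixing M \<epsilon> L \<sigma> X \<alpha>\<^sub>0 \<alpha>\<^sub>1 l\<^sub>1
    by unfold_locales
      (fact L_moment eps_moment alpha1_less mixing1 mixing2_pos mixing2_neg mixing3)+
  show ?thesis
    using unique_correct_sign[OF n s0 a0 g0] alpha1_hat_consistent[OF a0 g0]
      l1_hat_consistent[OF s0] alpha0_hat_consistent by blast
qed

end
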